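(* Let $\kappa$ be an infinite cardinal, $\nu$ a cardinal, $m,n$ natural numbers (possibly $0$), and $D$ an ultrafilter. (a) If $|\prod_D \nu^{\kappa^{+n}}|>\nu^{\kappa^{+n}}$ (in particular, this holds if $D$ is $(\nu^{\kappa^{+n}},\nu^{\kappa^{+n}})$-regular), then $D$ is $\mu$-decomposable for some cardinal $\mu$ with $\kappa\leq\mu\leq\nu^\kappa$. If in addition $\nu^\kappa=\kappa^{+p}$ for some $p<\omega$, then $D$ is $(\kappa,\kappa)$-regular. (a$'$) If $m\geq 1$ and $|\prod_D \beth_m(\kappa^{+n})|>\beth_m(\kappa^{+n})$ (in particular, this holds if $D$ is $(\beth_m(\kappa^{+n}),\beth_m(\kappa^{+n}))$-regular), then $D$ is $\mu$-decomposable for some cardinal $\mu$ with $\kappa\leq\mu\leq 2^\kappa$. If in addition $2^\kappa=\kappa^{+p}$ for some $p<\omega$, then $D$ is $(\kappa,\kappa)$-regular. (b) Suppose that $\kappa$ is a strong limit cardinal and that $|\prod_D \beth_m(\kappa^{+n})|>\beth_m(\kappa^{+n})$ (in particular, this holds if $D$ is $(\beth_m(\kappa^{+n}),\beth_m(\kappa^{+n}))$-regular). Then either $D$ is $(\operatorname{cf}\kappa,\operatorname{cf}\kappa)$-regular, or there are arbitrarily large $\mu<\kappa$ for which $D$ is $\mu$-decomposable.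
   Context: We work in ZFC. For infinite cardinals $\mu,\lambda$, an ultrafilter $D$ over a set $I$ is $(\mu,\lambda)$-regular if there is an indexed family $(X_\alpha)_{\alpha<\lambda}$ of members of $D$ such that $\bigcap_{\alpha\in A}X_\alpha=\emptyset$ whenever $A\subseteq\lambda$ and $|A|=\mu$. $D$ is $\lambda$-decomposable if there is a function $f:I\to\lambda$ such that $f^{-1}(X)\notin D$ whenever $X\subseteq\lambda$ and $|X|<\lambda$. "There are arbitrarily large $\mu<\kappa$ for which $D$ is $\mu$-decomposable" means that for every cardinal $\mu'<\kappa$ there is $\mu$ with $\mu'<\mu<\kappa$ such that $D$ is $\mu$-decomposable. For a cardinal $\chi$, $\prod_D\chi$ denotes the ultrapower of $\chi$ modulo $D$. $\kappa^{+n}$ is the $n$th successor cardinal of $\kappa$ (so $\kappa^{+0}=\kappa$). $\beth_0(\lambda)=\lambda$ and $\beth_{n+1}(\lambda)=2^{\beth_n(\lambda)}$. $\omega$ counts as a strong limit cardinal. *)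

theory Defs
  imports Main
begin

unbundle cardinal_syntax

text \<open>
  A cardinal is a relation \<open>r\<close> with \<^term>\<open>Card_order r\<close>, an initial well-order on its field; it is
  determined up to \<open>=o\<close>, and cardinals over different types are compared by \<open>=o\<close>, \<open>\<le>o\<close>, \<open><o\<close>.
  An index set is a type \<open>'i\<close>, and an ultrafilter over it is a filter on \<open>'i\<close>: a set \<open>X\<close> is a member
  of \<open>D\<close> if \<open>\<forall>\<^sub>F i in D. i \<in> X\<close>. Principal ultrafilters are not excluded.
\<close>

definition ultrafilter :: "'i filter \<Rightarrow> bool" where
  "ultrafilter D \<longleftrightarrow> D \<noteq> bot \<and> (\<forall>X. (\<forall>\<^sub>F i in D. i \<in> X) \<or> (\<forall>\<^sub>F i in D. i \<notin> X))"

definition regular :: "'i filter \<Rightarrow> 'm rel \<Rightarrow> 'l rel \<Rightarrow> bool" where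
  "regular D \<mu> l \<longleftrightarrow> Cinfinite \<mu> \<and> Cinfinite l \<and>
     (\<exists>X :: 'l \<Rightarrow> 'i set.
        (\<forall>\<alpha>\<in>Field l. \<forall>\<^sub>F i in D. i \<in> X \<alpha>) \<and>
        (\<forall>A. A \<subseteq> Field l \<and> |A| =o \<mu> \<longrightarrow> (\<Inter>\<alpha>\<in>A. X \<alpha>) = {}))"

definition decomposable :: "'i filter \<Rightarrow> 'l rel \<Rightarrow> bool" where
  "decomposable D l \<longleftrightarrow> Cinfinite l \<and>
     (\<exists>f :: 'i \<Rightarrow> 'l. range f \<subseteq> Field l \<and>
        (\<forall>X. X \<subseteq> Field l \<and> |X| <o l \<longrightarrow> \<not> (\<forall>\<^sub>F i in D. i \<in> f -` X)))"

definition ultrapower :: "'i filter \<Rightarrow> 'a set \<Rightarrow> ('i \<Rightarrow> 'a) set set" where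
  "ultrapower D A =
     {f. range f \<subseteq> A} // {(f, g). range f \<subseteq> A \<and> range g \<subseteq> A \<and> (\<forall>\<^sub>F i in D. f i = g i)}"

text \<open>
  The type of \<^term>\<open>cardSuc r\<close> differs from that of \<open>r\<close>, and likewise for powers, so iterating these
  operations a variable number of times is not a function in HOL. Instead, \<open>is_csuc_iter \<kappa> n l\<close> says
  that \<open>l\<close> is a copy of \<open>\<kappa>\<^sup>+\<^sup>n\<close> and \<open>is_beth l m b\<close> that \<open>b\<close> is a copy of \<open>\<beth>\<^sub>m(l)\<close>. The
  intermediate cardinals are no larger than the final one, so they can be taken on its type.
\<close>

primrec is_csuc_iter :: "'k rel \<Rightarrow> nat \<Rightarrow> 'l rel \<Rightarrow> bool" where
  "is_csuc_iter \<kappa> 0 l \<longleftrightarrow> Card_order l \<and> l =o \<kappa>"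
| "is_csuc_iter \<kappa> (Suc n) l \<longleftrightarrow>
     Card_order l \<and> (\<exists>l' :: 'l rel. is_csuc_iter \<kappa> n l' \<and> l =o cardSuc l')"

primrec is_beth :: "'l rel \<Rightarrow> nat \<Rightarrow> 'b rel \<Rightarrow> bool" where
  "is_beth l 0 b \<longleftrightarrow> Card_order b \<and> b =o l"
| "is_beth l (Suc m) b \<longleftrightarrow>
     Card_order b \<and> (\<exists>b' :: 'b rel. is_beth l m b' \<and> b =o ctwo ^c b')"

definition strong_limit :: "'k rel \<Rightarrow> bool" where
  "strong_limit \<kappa> \<longleftrightarrow> Cinfinite \<kappa> \<and> (\<forall>\<mu> :: 'k rel. Card_order \<mu> \<and> \<mu> <o \<kappa> \<longrightarrow> ctwo ^c \<mu> <o \<kappa>)"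

text \<open>
  Cofinality, meant for infinite cardinals. The library's \<^term>\<open>cofinal A r\<close> asks for strict upper
  bounds, which for orders without a last element is the usual notion.
\<close>

definition cf :: "'k rel \<Rightarrow> 'k rel" where
  "cf r = |SOME A. A \<subseteq> Field r \<and> cofinal A r \<and>
                   (\<forall>B. B \<subseteq> Field r \<and> cofinal B r \<longrightarrow> |A| \<le>o |B| )|"

end

theory Submission
  imports Defs
begin

text \<open>
  If \<open>D\<close> is not \<open>\<mu>\<close>-decomposable for any \<open>\<mu>\<close> between \<open>\<kappa>\<close> and \<open>\<nu>\<^sup>\<kappa>\<close>, then every function into a set of
  size \<open>\<nu>\<^sup>\<kappa>\<close> takes fewer than \<open>\<kappa>\<close> values modulo \<open>D\<close>. A sequence of \<open>\<kappa>\<close> functions into such a set is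
  again one such function, so it cannot keep producing new partitions: all functions into the set
  factor through a single one with fewer than \<open>\<kappa>\<close> values, and the ultrapower of \<open>\<nu>\<^sup>\<kappa>\<close> has size at
  most \<open>\<nu>\<^sup>\<kappa>\<close>. Since regularity descends from \<open>\<lambda>\<^sup>+\<close> to \<open>\<lambda>\<close>, no function into \<open>\<kappa>\<^sup>+\<^sup>j\<close>, \<open>j \<ge> 1\<close>, is unbounded modulo
  \<open>D\<close>; hence a function into \<open>\<nu>\<^sup>\<lambda>\<close>, \<open>\<lambda> = \<kappa>\<^sup>+\<^sup>n\<close>, is determined modulo \<open>D\<close> by its restrictions to initial
  segments of \<open>\<lambda>\<close>, and the bound carries over to \<open>\<nu>\<^sup>\<lambda>\<close>. Internal subsets carry it
  from \<open>\<lambda>\<close> to \<open>2\<^sup>\<lambda>\<close>. If \<open>\<kappa>\<close> is a strong limit and the decomposability cardinals below \<open>\<kappa>\<close> are bounded,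
  then this applied to large \<open>\<rho> < \<kappa>\<close> bounds the ultrapowers of the initial segments of \<open>\<kappa>\<close>, hence that of
  \<open>\<kappa>\<close> itself unless some function into \<open>\<kappa>\<close> is unbounded modulo \<open>D\<close>, which gives
  \<open>(cf \<kappa>, cf \<kappa>)\<close>-regularity.
\<close>

section \<open>Regularity, decomposability and functions unbounded modulo an ultrafilter\<close>

text \<open>In the ultrapower of the order \<open>r\<close>, the class of \<open>h\<close> is an
  upper bound of all constant functions. Such functions link regularity, decomposability and the
  size of ultrapowers.\<close>

definition unbounded_mod :: "'i filter \<Rightarrow> 'l rel \<Rightarrow> ('i \<Rightarrow> 'l) \<Rightarrow> bool" where
  "unbounded_mod D r h \<longleftrightarrow> range h \<subseteq> Field r \<and> (\<forall>a\<in>Field r. \<forall>\<^sub>F i in D. (a, h i) \<in> r)"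

lemma ultrafilter_not_eventually:
  assumes "ultrafilter D" "\<not> eventually P D"
  shows "eventually (\<lambda>i. \<not> P i) D"
  using assms(1)[unfolded ultrafilter_def, THEN conjunct2, rule_format, of "Collect P"] assms(2)
  by simp

lemma ultrafilter_obtain:
  assumes "ultrafilter D" "eventually P D"
  obtains i where "P i"
  using assms eventually_happens' unfolding ultrafilter_def by blast

lemma Card_order_linear:
  assumes "Card_order r" "a \<in> Field r" "b \<in> Field r" "(a, b) \<notin> r"
  shows "(b, a) \<in> r" "b \<noteq> a"
  using assms wo_rel.TOTALS[OF Card_order_wo_rel[OF assms(1)]] by auto

lemma Card_order_refl: "Card_order r \<Longrightarrow> a \<in> Field r \<Longrightarrow> (a, a) \<in> r"
  using wo_rel.TOTALS[OF Card_order_wo_rel] by blast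

lemma Card_order_transD: "Card_order r \<Longrightarrow> (a, b) \<in> r \<Longrightarrow> (b, c) \<in> r \<Longrightarrow> (a, c) \<in> r"
  using wo_rel.TRANS[OF Card_order_wo_rel] by (meson transD)

lemma Card_order_antisym: "Card_order r \<Longrightarrow> (a, b) \<in> r \<Longrightarrow> (b, a) \<in> r \<Longrightarrow> a = b"
  using wo_rel.ANTISYM[OF Card_order_wo_rel] by (meson antisymD)

lemma Card_order_ordLess_or_ordLeq:
  "Card_order r \<Longrightarrow> Card_order s \<Longrightarrow> r <o s \<or> s \<le>o r"
  by (simp add: card_order_on_well_order_on ordLess_or_ordLeq)

lemma card_of_subset_Field: "Card_order r \<Longrightarrow> A \<subseteq> Field r \<Longrightarrow> |A| \<le>o r"
  by (meson card_of_Field_ordIso card_of_mono1 ordLeq_ordIso_trans)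

text \<open>An infinite cardinal has no last element, so the closed segment below \<open>a\<close>
  lies in an open one.\<close>

lemma card_of_under:
  assumes "Cinfinite r" "a \<in> Field r"
  shows "|under r a| <o r"
proof -
  obtain b where b: "b \<in> Field r" "a \<noteq> b" "(a, b) \<in> r"
    using infinite_Card_order_limit assms unfolding cinfinite_def by metis
  have "under r a \<subseteq> underS r b"
    using b assms Card_order_transD[of r] Card_order_antisym[of r]
    unfolding under_def underS_def by blast
  then show ?thesis
    using card_of_mono1 card_of_underS assms b ordLeq_ordLess_trans by meson
qed

text \<open>A point common to \<open>\<mu>\<close> many of the sets would have \<open>\<mu>\<close>
  many indices. Allowing any index set with at least \<open>\<mu>\<close> elements spares
  re-indexing later.\<close>

lemma regularI:
  fixes \<mu> :: "'m rel" and S :: "'s set" and D :: "'i filter"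
  assumes \<mu>: "Cinfinite \<mu>" and le: "\<mu> \<le>o |S|"
    and ev: "\<And>s. s \<in> S \<Longrightarrow> \<forall>\<^sub>F i in D. i \<in> X s"
    and small: "\<And>i. |{s\<in>S. i \<in> X s}| <o \<mu>"
  shows "regular D \<mu> \<mu>"
proof -
  have "|Field \<mu>| \<le>o |S|"
    using le \<mu> card_of_Field_ordIso ordIso_ordLeq_trans by blast
  then obtain f where f: "inj_on f (Field \<mu>)" "f ` Field \<mu> \<subseteq> S"
    using card_of_ordLeq by metis
  have "(\<Inter>\<alpha>\<in>A. X (f \<alpha>)) = {}" if A: "A \<subseteq> Field \<mu>" "|A| =o \<mu>" for A
  proof (rule ccontr)
    assume "(\<Inter>\<alpha>\<in>A. X (f \<alpha>)) \<noteq> {}"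
    then obtain i where "\<forall>\<alpha>\<in>A. i \<in> X (f \<alpha>)" by blast
    then have "f ` A \<subseteq> {s\<in>S. i \<in> X s}" using f A by blast
    moreover have "inj_on f A" using f A inj_on_subset by blast
    ultimately have "|A| \<le>o |{s\<in>S. i \<in> X s}|" using card_of_ordLeq by blast
    then have "|A| <o \<mu>" using small ordLeq_ordLess_trans by blast
    then show False using A(2) not_ordLess_ordIso by blast
  qed
  moreover have "\<forall>\<alpha>\<in>Field \<mu>. \<forall>\<^sub>F i in D. i \<in> X (f \<alpha>)" using f ev by blast
  ultimately show ?thesis unfolding regular_def using \<mu> by (auto intro!: exI[of _ "\<lambda>\<alpha>. X (f \<alpha>)"])
qed

text \<open>If a point \<open>i\<close> had \<open>\<mu>\<close> many indices, these would index a
  subfamily of size \<open>\<mu>\<close> with \<open>i\<close> in its intersection.\<close>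

lemma regularE:
  assumes "regular D \<mu> \<mu>"
  obtains X where "\<And>\<alpha>. \<alpha> \<in> Field \<mu> \<Longrightarrow> \<forall>\<^sub>F i in D. i \<in> X \<alpha>"
    and "\<And>i. |{\<alpha>\<in>Field \<mu>. i \<in> X \<alpha>}| <o \<mu>"
proof -
  obtain X where \<mu>: "Cinfinite \<mu>" and X: "\<forall>\<alpha>\<in>Field \<mu>. \<forall>\<^sub>F i in D. i \<in> X \<alpha>"
    and e: "\<forall>A. A \<subseteq> Field \<mu> \<and> |A| =o \<mu> \<longrightarrow> (\<Inter>\<alpha>\<in>A. X \<alpha>) = {}"
    using assms unfolding regular_def by blast
  have "|{\<alpha>\<in>Field \<mu>. i \<in> X \<alpha>}| <o \<mu>" (is "|?S| <o _") for i
  proof (rule ccontr)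
    assume "\<not> |?S| <o \<mu>"
    then have "\<mu> \<le>o |?S|"
      using \<mu> card_of_Card_order Card_order_ordLess_or_ordLeq by blast
    moreover have "|?S| \<le>o \<mu>" using card_of_subset_Field[of \<mu> ?S] \<mu> by blast
    ultimately have "|?S| =o \<mu>" using ordIso_iff_ordLeq by blast
    then have "(\<Inter>\<alpha>\<in>?S. X \<alpha>) = {}" by (intro e[rule_format]) simp
    moreover have "i \<in> (\<Inter>\<alpha>\<in>?S. X \<alpha>)" by simp
    ultimately show False by simp
  qed
  then show thesis using that X by blast
qed

lemma regular_Cinfinite: "regular D \<mu> l \<Longrightarrow> Cinfinite \<mu>"
  unfolding regular_def by blast

lemma regular_cong:
  fixes \<mu> :: "'m rel" and \<mu>' :: "'l rel"
  assumes "regular D \<mu> \<mu>" "\<mu> =o \<mu>'"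
  shows "regular D \<mu>' \<mu>'"
proof -
  obtain X where X: "\<And>\<alpha>. \<alpha> \<in> Field \<mu> \<Longrightarrow> \<forall>\<^sub>F i in D. i \<in> X \<alpha>"
    "\<And>i. |{\<alpha>\<in>Field \<mu>. i \<in> X \<alpha>}| <o \<mu>"
    by (rule regularE[OF assms(1)]) blast
  have \<mu>: "Cinfinite \<mu>" using regular_Cinfinite assms(1) by blast
  have "\<mu>' \<le>o |Field \<mu>|"
    using \<mu> assms(2) card_of_Field_ordIso ordIso_symmetric ordIso_transitive ordIso_imp_ordLeq by metis
  moreover have "Cinfinite \<mu>'" using Cinfinite_cong[OF assms(2) \<mu>] .
  moreover have "|{\<alpha>\<in>Field \<mu>. i \<in> X \<alpha>}| <o \<mu>'" for i
    using X(2) assms(2) ordLess_ordIso_trans by blast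
  ultimately show ?thesis using regularI[of \<mu>' "Field \<mu>" X D] X(1) by blast
qed

text \<open>The point \<open>i\<close> lies in the set with index \<open>a\<close> only if
  \<open>a\<close> is at most \<open>h i\<close>, so its indices lie in a proper initial segment of
  \<open>\<mu>\<close>.\<close>

lemma unbounded_imp_regular:
  assumes "Cinfinite \<mu>" "unbounded_mod D \<mu> h"
  shows "regular D \<mu> \<mu>"
proof (rule regularI[OF assms(1), of "Field \<mu>" "\<lambda>a. {i. (a, h i) \<in> \<mu>}" D])
  show "\<mu> \<le>o |Field \<mu>|" using assms(1) Card_order_iff_ordLeq_card_of by blast
  show "\<forall>\<^sub>F i in D. i \<in> {i. (s, h i) \<in> \<mu>}" if "s \<in> Field \<mu>" for s
    using that assms(2) unfolding unbounded_mod_def by simp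
  fix i
  have "h i \<in> Field \<mu>" using assms(2) unfolding unbounded_mod_def by blast
  moreover have "{s \<in> Field \<mu>. i \<in> {i. (s, h i) \<in> \<mu>}} \<subseteq> under \<mu> (h i)"
    unfolding under_def by auto
  ultimately show "|{s \<in> Field \<mu>. i \<in> {i. (s, h i) \<in> \<mu>}}| <o \<mu>"
    by (meson card_of_under[OF assms(1)] card_of_mono1 ordLeq_ordLess_trans)
qed

text \<open>As the order is linear and \<open>D\<close> an ultrafilter, an \<open>a\<close> that is
  not below \<open>h\<close> almost everywhere is strictly above \<open>h\<close> almost
  everywhere.\<close>

lemma bounded_mod:
  assumes D: "ultrafilter D" and r: "Card_order r" and h: "range h \<subseteq> Field r"
    and "\<not> unbounded_mod D r h"
  obtains a where "a \<in> Field r" "\<forall>\<^sub>F i in D. (h i, a) \<in> r \<and> h i \<noteq> a"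
proof -
  obtain a where a: "a \<in> Field r" "\<not> (\<forall>\<^sub>F i in D. (a, h i) \<in> r)"
    using assms unfolding unbounded_mod_def by blast
  have "\<forall>\<^sub>F i in D. (a, h i) \<notin> r" using ultrafilter_not_eventually[OF D a(2)] .
  then have "\<forall>\<^sub>F i in D. (h i, a) \<in> r \<and> h i \<noteq> a"
    by (rule eventually_mono) (metis Card_order_linear[OF r a(1)] h rangeI subsetD)
  then show thesis by (rule that[OF a(1)])
qed

lemma decomposableE:
  assumes "decomposable D \<mu>"
  obtains f where "Cinfinite \<mu>" "range f \<subseteq> Field \<mu>"
    and "\<forall>X. X \<subseteq> Field \<mu> \<and> |X| <o \<mu> \<longrightarrow> \<not> (\<forall>\<^sub>F i in D. i \<in> f -` X)"
  using assms unfolding decomposable_def by (elim conjE exE) (intro that conjI)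

text \<open>A bound would place almost all values of \<open>f\<close> in a proper initial segment of
  \<open>\<mu>\<close>, which has fewer than \<open>\<mu>\<close> elements.\<close>

lemma decomposable_imp_regular:
  assumes D: "ultrafilter D" and "decomposable D \<mu>"
  shows "regular D \<mu> \<mu>"
proof -
  obtain f where \<mu>: "Cinfinite \<mu>" and f: "range f \<subseteq> Field \<mu>"
    and ns: "\<forall>X. X \<subseteq> Field \<mu> \<and> |X| <o \<mu> \<longrightarrow> \<not> (\<forall>\<^sub>F i in D. i \<in> f -` X)"
    by (rule decomposableE[OF assms(2)])
  have "unbounded_mod D \<mu> f"
  proof (rule ccontr)
    assume "\<not> unbounded_mod D \<mu> f"
    then obtain a where a: "a \<in> Field \<mu>" "\<forall>\<^sub>F i in D. (f i, a) \<in> \<mu> \<and> f i \<noteq> a"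
      using bounded_mod[OF D _ f] \<mu> by blast
    have "\<forall>\<^sub>F i in D. i \<in> f -` underS \<mu> a"
      using a(2) by (rule eventually_mono) (auto simp: underS_def)
    moreover have "underS \<mu> a \<subseteq> Field \<mu>"
      by (auto simp: underS_def Field_def)
    moreover have "|underS \<mu> a| <o \<mu>" using card_of_underS \<mu> a(1) by metis
    ultimately show False using ns[THEN spec, of "underS \<mu> a"] by simp
  qed
  then show ?thesis using unbounded_imp_regular \<mu> by blast
qed

lemma regularCard_bounded:
  assumes "Card_order \<mu>" "regularCard \<mu>" "A \<subseteq> Field \<mu>" "|A| <o \<mu>"
  shows "\<exists>a\<in>Field \<mu>. \<forall>b\<in>A. (b, a) \<in> \<mu>"
proof -
  have "\<not> cofinal A \<mu>" using assms not_ordLess_ordIso unfolding regularCard_def by blast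
  then show ?thesis
    using assms Card_order_linear[of \<mu>] Card_order_refl[of \<mu>] unfolding cofinal_def by blast
qed

text \<open>Each point has fewer than \<open>\<mu>\<close> indices. As the cardinal is regular, they
  have an upper bound, which is the value of \<open>f\<close> there.\<close>

lemma regular_imp_unbounded:
  assumes "regular D \<mu> \<mu>" and reg: "regularCard \<mu>"
  obtains f where "unbounded_mod D \<mu> f"
proof -
  obtain X where X: "\<And>\<alpha>. \<alpha> \<in> Field \<mu> \<Longrightarrow> \<forall>\<^sub>F i in D. i \<in> X \<alpha>"
    "\<And>i. |{\<alpha>\<in>Field \<mu>. i \<in> X \<alpha>}| <o \<mu>"
    by (rule regularE[OF assms(1)]) blast
  have \<mu>: "Cinfinite \<mu>" using regular_Cinfinite assms(1) by blast
  let ?S = "\<lambda>i. {\<alpha>\<in>Field \<mu>. i \<in> X \<alpha>}"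
  have "\<forall>i. \<exists>a. a \<in> Field \<mu> \<and> (\<forall>b\<in>?S i. (b, a) \<in> \<mu>)"
    using regularCard_bounded[OF \<mu>[THEN conjunct2] reg _ X(2)]
    by (metis (mono_tags, lifting) mem_Collect_eq subsetI)
  then obtain f where f: "\<forall>i. f i \<in> Field \<mu> \<and> (\<forall>b\<in>?S i. (b, f i) \<in> \<mu>)"
    by (rule choice[THEN exE])
  show thesis
  proof (rule that[of f], unfold unbounded_mod_def, intro conjI ballI)
    show "range f \<subseteq> Field \<mu>" using f by blast
    show "\<forall>\<^sub>F i in D. (a, f i) \<in> \<mu>" if "a \<in> Field \<mu>" for a
      using X(1)[OF that] by (rule eventually_mono) (use f that in blast)
  qed
qed

lemma unbounded_imp_decomposable:
  assumes D: "ultrafilter D" and \<mu>: "Cinfinite \<mu>" and reg: "regularCard \<mu>" and f: "unbounded_mod D \<mu> f"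
  shows "decomposable D \<mu>"
proof -
  have "\<not> (\<forall>\<^sub>F i in D. i \<in> f -` Y)" if Y: "Y \<subseteq> Field \<mu>" "|Y| <o \<mu>" for Y
  proof
    assume ev: "\<forall>\<^sub>F i in D. i \<in> f -` Y"
    obtain a where a: "a \<in> Field \<mu>" "\<forall>b\<in>Y. (b, a) \<in> \<mu>"
      using regularCard_bounded[OF _ reg Y] \<mu> by blast
    \<comment> \<open>Passing to \<open>c\<close> strictly above \<open>a\<close> makes the
      contradiction: \<open>f i \<in> Y\<close> puts \<open>f i\<close> at or below
      \<open>a\<close>, while \<open>f i\<close> is at or above \<open>c\<close>.\<close>
    obtain c where c: "c \<in> Field \<mu>" "a \<noteq> c" "(a, c) \<in> \<mu>"
      using infinite_Card_order_limit a(1) \<mu> unfolding cinfinite_def by metis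
    have "\<forall>\<^sub>F i in D. (c, f i) \<in> \<mu>" using f c(1) unfolding unbounded_mod_def by blast
    then obtain i where "f i \<in> Y" "(c, f i) \<in> \<mu>"
      using ultrafilter_obtain[OF D eventually_conj[OF ev]] by auto
    then have "(c, a) \<in> \<mu>" using a(2) Card_order_transD \<mu> by metis
    then show False using c Card_order_antisym \<mu> by metis
  qed
  moreover have "range f \<subseteq> Field \<mu>" using f unfolding unbounded_mod_def by blast
  ultimately show ?thesis
    using \<mu> unfolding decomposable_def by (intro conjI exI[of _ f] allI impI) simp_all
qed

lemma regular_imp_decomposable:
  assumes "ultrafilter D" "regular D \<mu> \<mu>" "regularCard \<mu>"
  shows "decomposable D \<mu>"
  using regular_imp_unbounded[OF assms(2,3)]
    unbounded_imp_decomposable[OF assms(1) regular_Cinfinite[OF assms(2)] assms(3)] by metis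

lemma decomposable_cong:
  assumes "decomposable D \<mu>" "\<mu> =o \<mu>'"
  shows "decomposable D \<mu>'"
proof -
  obtain f where \<mu>: "Cinfinite \<mu>" and f: "range f \<subseteq> Field \<mu>"
    and ns: "\<forall>X. X \<subseteq> Field \<mu> \<and> |X| <o \<mu> \<longrightarrow> \<not> (\<forall>\<^sub>F i in D. i \<in> f -` X)"
    by (rule decomposableE[OF assms(1)])
  have \<mu>': "Cinfinite \<mu>'" using Cinfinite_cong[OF assms(2) \<mu>] .
  obtain e where e: "bij_betw e (Field \<mu>) (Field \<mu>')"
    using card_of_cong[OF assms(2)] card_of_ordIso by blast
  have "\<not> (\<forall>\<^sub>F i in D. i \<in> (e \<circ> f) -` X)" if X: "X \<subseteq> Field \<mu>'" "|X| <o \<mu>'" for X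
  proof
    let ?Y = "{y\<in>Field \<mu>. e y \<in> X}"
    assume "\<forall>\<^sub>F i in D. i \<in> (e \<circ> f) -` X"
    then have "\<forall>\<^sub>F i in D. i \<in> f -` ?Y" by (rule eventually_mono) (use f in auto)
    moreover have "|?Y| \<le>o |X|"
      using e by (intro card_of_ordLeqI[of e]) (auto simp: bij_betw_def inj_on_def)
    then have "|?Y| <o \<mu>"
      using X(2) assms(2) ordIso_symmetric ordLess_ordIso_trans ordLeq_ordLess_trans by meson
    ultimately show False using ns[THEN spec, of ?Y] by blast
  qed
  moreover have "range (e \<circ> f) \<subseteq> Field \<mu>'" using f e by (auto simp: bij_betw_def)
  ultimately show ?thesis using \<mu>' unfolding decomposable_def by blast
qed

section \<open>The cardinality of ultrapowers\<close>

lemma ordLeq_card_of_Field_iff: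
  assumes "Card_order r"
  shows "s \<le>o |Field r| \<longleftrightarrow> s \<le>o r"
  using card_of_Field_ordIso[OF assms] ordIso_symmetric ordLeq_ordIso_trans by metis

text \<open>\<open>\<Phi>\<close> is evaluated at one chosen representative of each class, so it may
  take different values on functions equal modulo \<open>D\<close>.\<close>

lemma card_of_ultrapower_leI:
  fixes D :: "'i filter" and A :: "'a set"
  assumes D: "ultrafilter D"
    and into: "\<And>f. range f \<subseteq> A \<Longrightarrow> \<Phi> f \<in> B"
    and inj: "\<And>f g. range f \<subseteq> A \<Longrightarrow> range g \<subseteq> A \<Longrightarrow> \<Phi> f = \<Phi> g \<Longrightarrow> \<forall>\<^sub>F i in D. f i = g i"
  shows "|ultrapower D A| \<le>o |B|"
proof -
  define U where "U = {f :: 'i \<Rightarrow> 'a. range f \<subseteq> A}"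
  define R where "R = {(f :: 'i \<Rightarrow> 'a, g). range f \<subseteq> A \<and> range g \<subseteq> A \<and> (\<forall>\<^sub>F i in D. f i = g i)}"
  have eq: "equiv U R"
    unfolding U_def R_def
    by (rule equivI) (auto simp: refl_on_def sym_def trans_def eq_commute elim: eventually_elim2)
  define rep where "rep c = (SOME f. f \<in> c)" for c :: "('i \<Rightarrow> 'a) set"
  have rep: "rep c \<in> c" "rep c \<in> U" if "c \<in> U // R" for c
  proof -
    have "c \<noteq> {}" using in_quotient_imp_non_empty[OF eq that] .
    then show "rep c \<in> c" unfolding rep_def by (simp add: some_in_eq)
    then show "rep c \<in> U" using in_quotient_imp_subset[OF eq that] by blast
  qed
  have "inj_on (\<Phi> \<circ> rep) (U // R)"
  proof (rule inj_onI)
    fix c d assume cd: "c \<in> U // R" "d \<in> U // R" "(\<Phi> \<circ> rep) c = (\<Phi> \<circ> rep) d"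
    have "(rep c, rep d) \<in> R"
      using inj[of "rep c" "rep d"] rep(2)[OF cd(1)] rep(2)[OF cd(2)] cd(3)
      unfolding R_def U_def by simp
    then show "c = d" using quotient_eqI[OF eq cd(1,2) rep(1)[OF cd(1)] rep(1)[OF cd(2)]] by simp
  qed
  moreover have "(\<Phi> \<circ> rep) c \<in> B" if "c \<in> U // R" for c
    using into rep(2)[OF that] unfolding U_def by simp
  ultimately show ?thesis unfolding ultrapower_def U_def[symmetric] R_def[symmetric]
    by (rule card_of_ordLeqI)
qed

text \<open>\<open>\<Phi>\<close> is the passage to classes followed by an injection. Together with
  the converse above this keeps quotients out of later arguments.\<close>

lemma card_of_ultrapower_leE:
  fixes D :: "'i filter" and A :: "'a set"
  assumes D: "ultrafilter D" and le: "|ultrapower D A| \<le>o |B|"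
  obtains \<Phi> where "\<And>f. range f \<subseteq> A \<Longrightarrow> \<Phi> f \<in> B"
    and "\<And>f g. range f \<subseteq> A \<Longrightarrow> range g \<subseteq> A \<Longrightarrow> \<Phi> f = \<Phi> g \<Longrightarrow> \<forall>\<^sub>F i in D. f i = g i"
proof -
  define U where "U = {f :: 'i \<Rightarrow> 'a. range f \<subseteq> A}"
  define R where "R = {(f :: 'i \<Rightarrow> 'a, g). range f \<subseteq> A \<and> range g \<subseteq> A \<and> (\<forall>\<^sub>F i in D. f i = g i)}"
  have eq: "equiv U R"
    unfolding U_def R_def
    by (rule equivI) (auto simp: refl_on_def sym_def trans_def eq_commute elim: eventually_elim2)
  obtain e where e: "inj_on e (U // R)" "e ` (U // R) \<subseteq> B"
    using le unfolding ultrapower_def U_def[symmetric] R_def[symmetric] card_of_ordLeq[symmetric] by (elim exE conjE)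
  show thesis
  proof (rule that[of "\<lambda>f. e (R `` {f})"])
    show "e (R `` {f}) \<in> B" if "range f \<subseteq> A" for f
      using that e(2) quotientI[of f U R] unfolding U_def by blast
    fix f g assume fg: "range f \<subseteq> A" "range g \<subseteq> A" "e (R `` {f}) = e (R `` {g})"
    have "R `` {f} = R `` {g}"
      using fg e(1) quotientI[of _ U R] unfolding U_def by (auto dest: inj_onD)
    then have "(f, g) \<in> R" using eq_equiv_class[OF _ eq] fg(2) unfolding U_def by blast
    then show "\<forall>\<^sub>F i in D. f i = g i" unfolding R_def by blast
  qed
qed

lemma card_of_ultrapower_mono:
  assumes D: "ultrafilter D" and AB: "|A| \<le>o |B|" and B: "|ultrapower D B| \<le>o |C|"
  shows "|ultrapower D A| \<le>o |C|"
proof -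
  obtain e where e: "inj_on e A" "e ` A \<subseteq> B"
    using AB unfolding card_of_ordLeq[symmetric] by (elim exE conjE)
  obtain \<Phi> where \<Phi>: "\<And>f. range f \<subseteq> B \<Longrightarrow> \<Phi> f \<in> C"
    "\<And>f g. range f \<subseteq> B \<Longrightarrow> range g \<subseteq> B \<Longrightarrow> \<Phi> f = \<Phi> g \<Longrightarrow> \<forall>\<^sub>F i in D. f i = g i"
    using card_of_ultrapower_leE[OF D B] by blast
  have r: "range (e \<circ> f) \<subseteq> B" if "range f \<subseteq> A" for f using e that by auto
  show ?thesis
  proof (rule card_of_ultrapower_leI[OF D, of A "\<lambda>f. \<Phi> (e \<circ> f)"])
    show "\<Phi> (e \<circ> f) \<in> C" if "range f \<subseteq> A" for f using \<Phi>(1)[OF r[OF that]] .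
    fix f g assume fg: "range f \<subseteq> A" "range g \<subseteq> A" "\<Phi> (e \<circ> f) = \<Phi> (e \<circ> g)"
    have "\<forall>\<^sub>F i in D. (e \<circ> f) i = (e \<circ> g) i" using \<Phi>(2)[OF r[OF fg(1)] r[OF fg(2)] fg(3)] .
    then show "\<forall>\<^sub>F i in D. f i = g i"
    proof (rule eventually_mono)
      fix i assume "(e \<circ> f) i = (e \<circ> g) i"
      moreover have "f i \<in> A" "g i \<in> A" using fg by auto
      ultimately show "f i = g i" using e(1) by (simp add: inj_on_eq_iff)
    qed
  qed
qed

text \<open>Each \<open>i\<close> meets fewer than \<open>r\<close> of the sets \<open>X \<alpha>\<close>, so one can diagonalise at \<open>i\<close> against
  only those members of a list of length \<open>r\<close> whose index \<open>\<alpha>\<close> satisfies \<open>i \<in> X \<alpha>\<close>.\<close>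
lemma regular_imp_ordLess_ultrapower:
  assumes D: "ultrafilter D" and reg: "regular D r r"
  shows "r <o |ultrapower D (Field r)|"
proof (rule ccontr)
  have r: "Cinfinite r" using regular_Cinfinite[OF reg] .
  assume "\<not> r <o |ultrapower D (Field r)|"
  then have "|ultrapower D (Field r)| \<le>o r"
    using Card_order_ordLess_or_ordLeq[OF _ card_of_Card_order] r by blast
  then have "|ultrapower D (Field r)| \<le>o |Field r|"
    using ordLeq_card_of_Field_iff r by blast
  then obtain \<Phi> where \<Phi>: "\<And>f. range f \<subseteq> Field r \<Longrightarrow> \<Phi> f \<in> Field r"
    "\<And>f g. range f \<subseteq> Field r \<Longrightarrow> range g \<subseteq> Field r \<Longrightarrow> \<Phi> f = \<Phi> g \<Longrightarrow> \<forall>\<^sub>F i in D. f i = g i"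
    using card_of_ultrapower_leE[OF D] by blast
  obtain X where X: "\<And>\<alpha>. \<alpha> \<in> Field r \<Longrightarrow> \<forall>\<^sub>F i in D. i \<in> X \<alpha>"
    "\<And>i. |{\<alpha>\<in>Field r. i \<in> X \<alpha>}| <o r"
    by (rule regularE[OF reg]) blast
  \<comment> \<open>A list of length \<open>r\<close> that meets every code; if
    \<open>\<alpha>\<close> codes no function, \<open>f \<alpha>\<close> is arbitrary and avoiding
    it does no harm.\<close>
  define f where "f \<alpha> = (SOME f. range f \<subseteq> Field r \<and> \<Phi> f = \<alpha>)" for \<alpha>
  have "\<exists>y. y \<in> Field r \<and> y \<notin> (\<lambda>\<alpha>. f \<alpha> i) ` {\<alpha>\<in>Field r. i \<in> X \<alpha>}" for i
  proof (rule ccontr)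
    assume "\<not> ?thesis"
    then have "Field r \<subseteq> (\<lambda>\<alpha>. f \<alpha> i) ` {\<alpha>\<in>Field r. i \<in> X \<alpha>}" by blast
    then have "|Field r| \<le>o |{\<alpha>\<in>Field r. i \<in> X \<alpha>}|" by (rule surj_imp_ordLeq)
    then have "|Field r| <o r" using X(2) ordLeq_ordLess_trans by blast
    then show False using card_of_Field_ordIso r not_ordLess_ordIso by blast
  qed
  then obtain g where g: "\<And>i. g i \<in> Field r" "\<And>i \<alpha>. \<alpha> \<in> Field r \<Longrightarrow> i \<in> X \<alpha> \<Longrightarrow> g i \<noteq> f \<alpha> i"
    by (metis (mono_tags, lifting) image_eqI mem_Collect_eq)
  have rg: "range g \<subseteq> Field r" using g(1) by blast
  have "range (f (\<Phi> g)) \<subseteq> Field r \<and> \<Phi> (f (\<Phi> g)) = \<Phi> g"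
    unfolding f_def by (rule someI[of _ g]) (simp add: rg)
  then have "\<forall>\<^sub>F i in D. f (\<Phi> g) i = g i" using \<Phi>(2) rg by blast
  then obtain i where "f (\<Phi> g) i = g i" "i \<in> X (\<Phi> g)"
    using ultrafilter_obtain[OF D eventually_conj[OF _ X(1)[OF \<Phi>(1)[OF rg]]]] by blast
  then show False using g(2)[OF \<Phi>(1)[OF rg]] by metis
qed

text \<open>Every function is bounded modulo \<open>D\<close> by some \<open>b\<close>, hence is
  determined by the pair of \<open>b\<close> and its code in the ultrapower of the segment below
  \<open>b\<close>. There are \<open>r\<close> times \<open>r\<close> such pairs.\<close>

lemma bounded_card_of_ultrapower:
  assumes D: "ultrafilter D" and r: "Cinfinite r" and nr: "\<And>h. \<not> unbounded_mod D r h"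
    and le: "\<And>b. b \<in> Field r \<Longrightarrow> |ultrapower D (under r b)| \<le>o r"
  shows "|ultrapower D (Field r)| \<le>o r"
proof -
  have le': "|ultrapower D (under r b)| \<le>o |Field r|" if "b \<in> Field r" for b
    using le[OF that] ordLeq_card_of_Field_iff r by blast
  define code where "code b \<Phi> \<longleftrightarrow> (\<forall>f. range f \<subseteq> under r b \<longrightarrow> \<Phi> f \<in> Field r) \<and>
     (\<forall>f g. range f \<subseteq> under r b \<and> range g \<subseteq> under r b \<and> \<Phi> f = \<Phi> g \<longrightarrow>
        (\<forall>\<^sub>F i in D. f i = g i))" for b \<Phi>
  have "\<exists>\<Phi>. code b \<Phi>" if "b \<in> Field r" for b
    unfolding code_def by (rule card_of_ultrapower_leE[OF D le'[OF that]]) blast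
  then obtain \<Phi> where "\<And>b. b \<in> Field r \<Longrightarrow> code b (\<Phi> b)" by metis
  then have \<Phi>:
    "\<And>b f. b \<in> Field r \<Longrightarrow> range f \<subseteq> under r b \<Longrightarrow> \<Phi> b f \<in> Field r"
    "\<And>b f g. b \<in> Field r \<Longrightarrow> range f \<subseteq> under r b \<Longrightarrow> range g \<subseteq> under r b
       \<Longrightarrow> \<Phi> b f = \<Phi> b g \<Longrightarrow> \<forall>\<^sub>F i in D. f i = g i"
    unfolding code_def by blast+
  define B where "B f = (SOME b. b \<in> Field r \<and> (\<forall>\<^sub>F i in D. f i \<in> under r b))" for f
  have B: "B f \<in> Field r" "\<forall>\<^sub>F i in D. f i \<in> under r (B f)" if rf: "range f \<subseteq> Field r" for f
  proof -
    obtain b where b: "b \<in> Field r" "\<forall>\<^sub>F i in D. (f i, b) \<in> r \<and> f i \<noteq> b"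
      using bounded_mod[OF D _ rf nr] r by blast
    have "\<forall>\<^sub>F i in D. f i \<in> under r b"
      using b(2) by (rule eventually_mono) (simp add: under_def)
    then have "\<exists>b. b \<in> Field r \<and> (\<forall>\<^sub>F i in D. f i \<in> under r b)" using b(1) by blast
    then have "B f \<in> Field r \<and> (\<forall>\<^sub>F i in D. f i \<in> under r (B f))"
      unfolding B_def by (rule someI_ex)
    then show "B f \<in> Field r" "\<forall>\<^sub>F i in D. f i \<in> under r (B f)" by blast+
  qed
  \<comment> \<open>\<open>f\<close> stays below \<open>B f\<close> only on a set of
    \<open>D\<close>. Resetting the other values gives a function with its whole range in the
    segment, as the code requires.\<close>
  define t where "t f i = (if f i \<in> under r (B f) then f i else B f)" for f i
  have t: "range (t f) \<subseteq> under r (B f)" if "range f \<subseteq> Field r" for f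
    using Card_order_refl[of r "B f"] B(1)[OF that] r unfolding t_def under_def by auto
  have tf: "\<forall>\<^sub>F i in D. t f i = f i" if "range f \<subseteq> Field r" for f
    using B(2)[OF that] by (rule eventually_mono) (simp add: t_def)
  have "|ultrapower D (Field r)| \<le>o |Field r \<times> Field r|"
  proof (rule card_of_ultrapower_leI[OF D, of _ "\<lambda>f. (B f, \<Phi> (B f) (t f))"])
    show "(B f, \<Phi> (B f) (t f)) \<in> Field r \<times> Field r" if "range f \<subseteq> Field r" for f
      using \<Phi>(1) B(1) t that by blast
    fix f g assume fg: "range f \<subseteq> Field r" "range g \<subseteq> Field r"
      and e: "(B f, \<Phi> (B f) (t f)) = (B g, \<Phi> (B g) (t g))"
    have B_eq: "B f = B g" and \<Phi>_eq: "\<Phi> (B f) (t f) = \<Phi> (B f) (t g)" using e by auto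
    have "range (t g) \<subseteq> under r (B f)" using t[OF fg(2)] B_eq by simp
    then have "\<forall>\<^sub>F i in D. t f i = t g i"
      by (rule \<Phi>(2)[OF B(1)[OF fg(1)] t[OF fg(1)] _ \<Phi>_eq])
    then show "\<forall>\<^sub>F i in D. f i = g i"
      using tf[OF fg(1)] tf[OF fg(2)] by eventually_elim simp
  qed
  then show ?thesis
    using Card_order_Times_same_infinite r ordLeq_transitive unfolding cinfinite_def by blast
qed

section \<open>Ultrapowers when functions have small range\<close>

text \<open>The sequence \<open>s\<close> is built so that \<open>s \<alpha>\<close> is not a function of \<open>(s \<beta>)\<^bsub>\<beta> < \<alpha>\<^esub>\<close> modulo \<open>D\<close>, as long
  as such a function exists. Were it to last for all \<open>\<alpha>\<close>, then \<open>(s \<beta>)\<^bsub>\<beta> \<in> Field \<kappa>\<^esub>\<close> would map a set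
  of \<open>D\<close> into some \<open>Y\<close> with fewer than \<open>\<kappa>\<close> elements, yet for every \<open>\<alpha>\<close> some two
  elements of \<open>Y\<close> would differ for the first time at \<open>\<alpha>\<close>.\<close>
lemma small_generator:
  fixes D :: "'i filter" and \<kappa> :: "'k rel" and A :: "'a set"
  assumes \<kappa>: "Cinfinite \<kappa>" and ne: "A \<noteq> {}"
    and small: "\<And>F. range F \<subseteq> Func (Field \<kappa>) A \<Longrightarrow> \<exists>Y. |Y| <o \<kappa> \<and> (\<forall>\<^sub>F i in D. F i \<in> Y)"
  obtains G :: "'i \<Rightarrow> 'k \<Rightarrow> 'a" and Z where "|Z| <o \<kappa>" "\<forall>\<^sub>F i in D. G i \<in> Z"
    and "\<And>f. range f \<subseteq> A \<Longrightarrow>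
      \<exists>P. eventually P D \<and> (\<forall>i j. P i \<and> P j \<and> G i = G j \<longrightarrow> f i = f j)"
proof -
  obtain a0 where a0: "a0 \<in> A" using ne by blast
  have wo: "wo_rel \<kappa>" using \<kappa> Card_order_wo_rel by blast
  \<comment> \<open>On some set of \<open>D\<close>, \<open>f\<close> is a function of the
    \<open>s \<beta>\<close> with \<open>\<beta>\<close> below \<open>\<alpha>\<close>.\<close>
  define fac where "fac s \<alpha> f \<longleftrightarrow> (\<exists>P. eventually P D \<and>
    (\<forall>i j. P i \<and> P j \<and> (\<forall>\<beta>\<in>underS \<kappa> \<alpha>. s \<beta> i = s \<beta> j) \<longrightarrow> f i = f j))"
    for s :: "'k \<Rightarrow> 'i \<Rightarrow> 'a" and \<alpha> and f :: "'i \<Rightarrow> 'a"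
  define H where "H s \<alpha> = (if \<exists>f. range f \<subseteq> A \<and> \<not> fac s \<alpha> f
    then SOME f. range f \<subseteq> A \<and> \<not> fac s \<alpha> f else (\<lambda>_. a0))" for s \<alpha>
  define s where "s = wo_rel.worec \<kappa> H"
  \<comment> \<open>\<open>H s \<alpha>\<close> looks at \<open>s\<close> only below
    \<open>\<alpha>\<close>, so the well-founded recursion is legitimate.\<close>
  have "wo_rel.adm_wo \<kappa> H"
    unfolding wo_rel.adm_wo_def[OF wo]
  proof (intro allI impI)
    fix s t :: "'k \<Rightarrow> 'i \<Rightarrow> 'a" and \<alpha>
    assume "\<forall>\<beta>\<in>underS \<kappa> \<alpha>. s \<beta> = t \<beta>"
    then have "fac s \<alpha> = fac t \<alpha>" unfolding fac_def by (intro ext) simp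
    then show "H s \<alpha> = H t \<alpha>" by (simp only: H_def)
  qed
  then have sH: "s = H s" unfolding s_def by (rule wo_rel.worec_fixpoint[OF wo])
  have sA: "range (s \<alpha>) \<subseteq> A" and nfac: "\<exists>f. range f \<subseteq> A \<and> \<not> fac s \<alpha> f \<Longrightarrow> \<not> fac s \<alpha> (s \<alpha>)" for \<alpha>
  proof -
    have *: "range (H s \<alpha>) \<subseteq> A \<and> \<not> fac s \<alpha> (H s \<alpha>)" if "\<exists>f. range f \<subseteq> A \<and> \<not> fac s \<alpha> f"
      using someI_ex[OF that] that unfolding H_def by simp
    have "range (H s \<alpha>) \<subseteq> A"
      using * a0 by (cases "\<exists>f. range f \<subseteq> A \<and> \<not> fac s \<alpha> f") (simp, auto simp: H_def)
    then show "range (s \<alpha>) \<subseteq> A" using sH by metis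
    show "\<not> fac s \<alpha> (s \<alpha>)" if "\<exists>f. range f \<subseteq> A \<and> \<not> fac s \<alpha> f"
      using *[OF that] sH by metis
  qed
  have sA': "s \<alpha> i \<in> A" for \<alpha> i using sA[of \<alpha>] by blast
  have "\<exists>\<alpha>\<in>Field \<kappa>. \<forall>f. range f \<subseteq> A \<longrightarrow> fac s \<alpha> f"
  proof (rule ccontr)
    assume "\<not> ?thesis"
    then have nf: "\<not> fac s \<alpha> (s \<alpha>)" if "\<alpha> \<in> Field \<kappa>" for \<alpha> using that nfac by blast
    \<comment> \<open>The whole sequence is bundled into a single function, to which
      \<open>small\<close> applies.\<close>
    define F where "F i = (\<lambda>\<beta>. if \<beta> \<in> Field \<kappa> then s \<beta> i else undefined)" for i
    have "range F \<subseteq> Func (Field \<kappa>) A" using sA' unfolding F_def Func_def by auto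
    then obtain Y where Y: "|Y| <o \<kappa>" "\<forall>\<^sub>F i in D. F i \<in> Y" using small by blast
    \<comment> \<open>Failure of factoring on the set where \<open>F i \<in> Y\<close> yields two
      points whose sequences agree below \<open>\<alpha>\<close> and differ at
      \<open>\<alpha>\<close>.\<close>
    have "\<exists>p. p \<in> Y \<times> Y \<and> (\<forall>\<beta>\<in>underS \<kappa> \<alpha>. fst p \<beta> = snd p \<beta>) \<and> fst p \<alpha> \<noteq> snd p \<alpha>"
      if \<alpha>: "\<alpha> \<in> Field \<kappa>" for \<alpha>
    proof -
      obtain i j where ij: "F i \<in> Y" "F j \<in> Y"
        "\<forall>\<beta>\<in>underS \<kappa> \<alpha>. s \<beta> i = s \<beta> j" "s \<alpha> i \<noteq> s \<alpha> j"
        using nf[OF \<alpha>] Y(2) unfolding fac_def by blast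
      have "underS \<kappa> \<alpha> \<subseteq> Field \<kappa>" unfolding underS_def Field_def by blast
      then show ?thesis using ij \<alpha> by (intro exI[of _ "(F i, F j)"]) (auto simp: F_def)
    qed
    then obtain p where p: "\<And>\<alpha>. \<alpha> \<in> Field \<kappa> \<Longrightarrow> p \<alpha> \<in> Y \<times> Y"
      "\<And>\<alpha> \<beta>. \<alpha> \<in> Field \<kappa> \<Longrightarrow> \<beta> \<in> underS \<kappa> \<alpha> \<Longrightarrow> fst (p \<alpha>) \<beta> = snd (p \<alpha>) \<beta>"
      "\<And>\<alpha>. \<alpha> \<in> Field \<kappa> \<Longrightarrow> fst (p \<alpha>) \<alpha> \<noteq> snd (p \<alpha>) \<alpha>"
      by metis
    \<comment> \<open>A pair determines the first place where its members differ. Hence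
      \<open>\<kappa>\<close> is at most the size of \<open>Y \<times> Y\<close>, which is too
      small.\<close>
    have "inj_on p (Field \<kappa>)"
    proof (rule inj_onI, rule ccontr)
      fix \<alpha> \<beta> assume ab: "\<alpha> \<in> Field \<kappa>" "\<beta> \<in> Field \<kappa>" "p \<alpha> = p \<beta>" "\<alpha> \<noteq> \<beta>"
      then have "\<alpha> \<in> underS \<kappa> \<beta> \<or> \<beta> \<in> underS \<kappa> \<alpha>"
        using Card_order_linear[of \<kappa> \<alpha> \<beta>] \<kappa> unfolding underS_def by auto
      then show False using p(2,3) ab by metis
    qed
    then have le: "|Field \<kappa>| \<le>o |Y \<times> Y|" using p(1) by (rule card_of_ordLeqI)
    then have "infinite Y"
      using card_of_ordLeq_finite[OF le] \<kappa> unfolding cinfinite_def by blast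
    then have "|Field \<kappa>| \<le>o |Y|" using ordLeq_ordIso_trans[OF le card_of_Times_same_infinite] by blast
    then have "|Field \<kappa>| <o \<kappa>" using Y(1) by (rule ordLeq_ordLess_trans)
    then show False using card_of_Field_ordIso[of \<kappa>] \<kappa> not_ordLess_ordIso by metis
  qed
  then obtain \<alpha> where \<alpha>: "\<alpha> \<in> Field \<kappa>" and fac: "\<And>f. range f \<subseteq> A \<Longrightarrow> fac s \<alpha> f" by blast
  \<comment> \<open>Only coordinates below \<open>\<alpha>\<close> carry information; padding with
    \<open>a0\<close> puts \<open>G i\<close> into \<open>Func (Field \<kappa>) A\<close>, so that
    \<open>small\<close> provides \<open>Z\<close>.\<close>
  define G where "G i = (\<lambda>\<beta>. if \<beta> \<in> Field \<kappa>
    then if \<beta> \<in> underS \<kappa> \<alpha> then s \<beta> i else a0 else undefined)" for i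
  have "range G \<subseteq> Func (Field \<kappa>) A" using sA' a0 unfolding G_def Func_def by auto
  then obtain Z where Z: "|Z| <o \<kappa>" "\<forall>\<^sub>F i in D. G i \<in> Z" using small by blast
  show thesis
  proof (rule that[OF Z])
    fix f :: "'i \<Rightarrow> 'a" assume "range f \<subseteq> A"
    then have "fac s \<alpha> f" by (rule fac)
    then obtain P where P: "eventually P D"
      "\<forall>i j. P i \<and> P j \<and> (\<forall>\<beta>\<in>underS \<kappa> \<alpha>. s \<beta> i = s \<beta> j) \<longrightarrow> f i = f j"
      unfolding fac_def by (elim exE conjE)
    have "s \<beta> i = s \<beta> j" if "G i = G j" "\<beta> \<in> underS \<kappa> \<alpha>" for i j \<beta>
    proof -
      have "\<beta> \<in> Field \<kappa>" using that(2) unfolding underS_def Field_def by blast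
      then show ?thesis using fun_cong[OF that(1), of \<beta>] that(2) unfolding G_def by simp
    qed
    then show "\<exists>P. eventually P D \<and> (\<forall>i j. P i \<and> P j \<and> G i = G j \<longrightarrow> f i = f j)"
      using P by (intro exI[of _ P]) blast
  qed
qed

text \<open>Modulo \<open>D\<close> every \<open>f\<close> is a map \<open>Z \<rightarrow> A\<close>
  composed with \<open>G\<close>, and these maps are counted.\<close>

lemma card_of_ultrapower_le_Func:
  fixes D :: "'i filter" and G :: "'i \<Rightarrow> 'z" and A :: "'a set"
  assumes D: "ultrafilter D" and ne: "A \<noteq> {}" and Z: "\<forall>\<^sub>F i in D. G i \<in> Z"
    and gen: "\<And>f. range f \<subseteq> A \<Longrightarrow>
      \<exists>P. eventually P D \<and> (\<forall>i j. P i \<and> P j \<and> G i = G j \<longrightarrow> f i = f j)"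
  shows "|ultrapower D A| \<le>o |Func Z A|"
proof -
  obtain a0 where a0: "a0 \<in> A" using ne by blast
  define P where "P f = (SOME P. eventually P D \<and> (\<forall>i j. P i \<and> P j \<and> G i = G j \<longrightarrow> f i = f j))"
    for f :: "'i \<Rightarrow> 'a"
  have P: "eventually (P f) D" "\<And>i j. P f i \<Longrightarrow> P f j \<Longrightarrow> G i = G j \<Longrightarrow> f i = f j"
    if "range f \<subseteq> A" for f
    using someI_ex[OF gen[OF that]] unfolding P_def[symmetric] by blast+
  \<comment> \<open>The value at \<open>z\<close> is read off at any point of the fibre of
    \<open>G\<close> that lies in \<open>P f\<close>; fibres missing \<open>P f\<close> receive
    \<open>a0\<close>.\<close>
  define \<Phi> where "\<Phi> f = (\<lambda>z. if z \<in> Z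
    then if \<exists>i. P f i \<and> G i = z then f (SOME i. P f i \<and> G i = z) else a0 else undefined)"
    for f :: "'i \<Rightarrow> 'a"
  have val: "\<Phi> f (G i) = f i" if "range f \<subseteq> A" "P f i" "G i \<in> Z" for f i
  proof -
    have ex: "\<exists>j. P f j \<and> G j = G i" using that(2) by blast
    have "f (SOME j. P f j \<and> G j = G i) = f i"
      using someI_ex[OF ex] P(2)[OF that(1) _ that(2)] by blast
    then show ?thesis using ex that(3) unfolding \<Phi>_def by simp
  qed
  show ?thesis
  proof (rule card_of_ultrapower_leI[OF D, of A \<Phi>])
    show "\<Phi> f \<in> Func Z A" if "range f \<subseteq> A" for f
      using that a0 unfolding \<Phi>_def Func_def by auto
    fix f g assume fg: "range f \<subseteq> A" "range g \<subseteq> A" "\<Phi> f = \<Phi> g"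
    show "\<forall>\<^sub>F i in D. f i = g i"
      using Z P(1)[OF fg(1)] P(1)[OF fg(2)]
      by eventually_elim (metis val fg)
  qed
qed

text \<open>Moves a cardinal to the type of a larger one; assumptions about all cardinals of a fixed
  type then apply to it.\<close>

lemma exists_Card_order_ordIso:
  fixes s :: "'s rel"
  assumes "r \<le>o s" "Card_order r"
  shows "\<exists>r' :: 's rel. Card_order r' \<and> r =o r'"
proof -
  obtain p :: "'s rel" where "r =o p" using assms(1) unfolding internalize_ordLeq[of r s] by blast
  then show ?thesis using Card_order_ordIso2[OF assms(2)] by blast
qed

text \<open>Among the subsets of \<open>B\<close> that contain almost all values of
  \<open>F\<close>, let \<open>Y\<close> have least cardinality. Minimality is exactly
  decomposability.\<close>

lemma decomposable_between:
  fixes D :: "'i filter" and \<kappa> :: "'k rel"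
  assumes D: "ultrafilter D" and \<kappa>: "Cinfinite \<kappa>" and F: "range F \<subseteq> B"
    and large: "\<And>Y. |Y| <o \<kappa> \<Longrightarrow> \<not> (\<forall>\<^sub>F i in D. F i \<in> Y)"
  obtains Y where "Y \<subseteq> B" "\<kappa> \<le>o |Y|" "decomposable D |Y|"
proof -
  define R where "R = {|Y| |Y. Y \<subseteq> B \<and> (\<forall>\<^sub>F i in D. F i \<in> Y)}"
  have "\<forall>\<^sub>F i in D. F i \<in> B" using F by (intro always_eventually) blast
  then have "|B| \<in> R" unfolding R_def by blast
  then have "R \<noteq> {}" by blast
  moreover have "\<forall>r\<in>R. Card_order r" using card_of_Card_order unfolding R_def by blast
  ultimately have "\<exists>r\<in>R. \<forall>r'\<in>R. r \<le>o r'" by (rule exists_minim_Card_order)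
  then obtain Y where Y: "Y \<subseteq> B" "\<forall>\<^sub>F i in D. F i \<in> Y"
    and "\<forall>r'\<in>R. |Y| \<le>o r'" unfolding R_def by blast
  then have min: "|Y| \<le>o |X|" if "X \<subseteq> B" "\<forall>\<^sub>F i in D. F i \<in> X" for X
    using that unfolding R_def by blast
  have le: "\<kappa> \<le>o |Y|"
    using Card_order_ordLess_or_ordLeq[of "|Y|" \<kappa>] card_of_Card_order \<kappa> large[of Y] Y(2) by metis
  have inf: "Cinfinite |Y|"
    using cinfinite_mono[OF le] \<kappa> card_of_Card_order by blast
  then obtain y0 where y0: "y0 \<in> Y" unfolding cinfinite_def Field_card_of by fastforce
  \<comment> \<open>Changing \<open>F\<close> off a set of \<open>D\<close> makes the range lie in
    \<open>Y\<close> everywhere.\<close>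
  define f where "f i = (if F i \<in> Y then F i else y0)" for i
  have "\<not> (\<forall>\<^sub>F i in D. i \<in> f -` X)" if X: "X \<subseteq> Y" "|X| <o |Y|" for X
  proof
    assume "\<forall>\<^sub>F i in D. i \<in> f -` X"
    then have "\<forall>\<^sub>F i in D. F i \<in> X" using Y(2) by eventually_elim (simp add: f_def)
    moreover have "X \<subseteq> B" using X(1) Y(1) by simp
    ultimately have "|Y| \<le>o |X|" using min by simp
    then show False using X(2) not_ordLess_ordLeq by metis
  qed
  moreover have "range f \<subseteq> Y" using y0 unfolding f_def by auto
  ultimately have "decomposable D |Y|"
    unfolding decomposable_def using inf
    by (intro conjI exI[of _ f] allI impI) (simp_all add: Field_card_of)
  then show thesis using that Y(1) le by metis
qed

text \<open>Since \<open>(\<nu> ^c \<kappa>) ^c \<kappa> =o \<nu> ^c \<kappa>\<close>, sequences of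
  length \<open>\<kappa>\<close> in \<open>A\<close> are no more numerous than elements of
  \<open>A\<close>. A function into them with large range modulo \<open>D\<close> would give a
  forbidden decomposability, so one generator with fewer than \<open>\<kappa>\<close> values exists
  and the ultrapower has size at most \<open>|A| ^c \<kappa>\<close>.\<close>

lemma card_of_ultrapower_cexp:
  fixes D :: "'i filter" and \<kappa> :: "'k rel" and \<nu> :: "'n rel"
  assumes D: "ultrafilter D" and \<kappa>: "Cinfinite \<kappa>" and \<nu>: "Card_order \<nu>" "ctwo \<le>o \<nu>"
    and nd: "\<And>\<mu> :: ('k \<Rightarrow> 'n) rel. Card_order \<mu> \<Longrightarrow> \<kappa> \<le>o \<mu> \<Longrightarrow> \<mu> \<le>o \<nu> ^c \<kappa> \<Longrightarrow> \<not> decomposable D \<mu>"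
  shows "|ultrapower D (Field (\<nu> ^c \<kappa>))| \<le>o \<nu> ^c \<kappa>"
proof -
  define A where "A = Func (Field \<kappa>) (Field \<nu>)"
  have A: "|A| = \<nu> ^c \<kappa>" unfolding A_def cexp_def ..
  have "Cinfinite (\<nu> ^c \<kappa>)" using Cinfinite_cexp \<nu> \<kappa> by blast
  then have ne: "A \<noteq> {}" unfolding A[symmetric] cinfinite_def Field_card_of by auto
  have "(\<nu> ^c \<kappa>) ^c \<kappa> =o \<nu> ^c \<kappa>"
    using cexp_cprod_ordLeq[OF \<nu>(1) \<kappa> Cinfinite_Cnotzero[OF \<kappa>] ordLeq_refl] \<kappa> by blast
  then have FA: "|Func (Field \<kappa>) A| \<le>o |A|"
    unfolding A[symmetric] cexp_def[of "|A|"] Field_card_of by (rule ordIso_imp_ordLeq)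
  have small: "\<exists>Y. |Y| <o \<kappa> \<and> (\<forall>\<^sub>F i in D. F i \<in> Y)" if F: "range F \<subseteq> Func (Field \<kappa>) A" for F
  proof (rule ccontr)
    assume "\<not> ?thesis"
    then obtain Y where Y: "Y \<subseteq> Func (Field \<kappa>) A" "\<kappa> \<le>o |Y|" "decomposable D |Y|"
      using decomposable_between[OF D \<kappa> F] by blast
    have YA: "|Y| \<le>o |A|" using ordLeq_transitive[OF card_of_mono1[OF Y(1)] FA] .
    obtain \<mu> :: "('k \<Rightarrow> 'n) rel" where \<mu>: "Card_order \<mu>" "|Y| =o \<mu>"
      using exists_Card_order_ordIso[OF YA card_of_Card_order] by blast
    have "\<mu> \<le>o \<nu> ^c \<kappa>" using ordIso_ordLeq_trans[OF ordIso_symmetric[OF \<mu>(2)] YA] unfolding A .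
    then show False
      using nd[OF \<mu>(1) ordLeq_ordIso_trans[OF Y(2) \<mu>(2)]] decomposable_cong[OF Y(3) \<mu>(2)] by simp
  qed
  obtain G :: "'i \<Rightarrow> 'k \<Rightarrow> 'k \<Rightarrow> 'n" and Z where Z: "|Z| <o \<kappa>" "\<forall>\<^sub>F i in D. G i \<in> Z"
    and G: "\<And>f. range f \<subseteq> A \<Longrightarrow>
      \<exists>P. eventually P D \<and> (\<forall>i j. P i \<and> P j \<and> G i = G j \<longrightarrow> f i = f j)"
    by (rule small_generator[OF \<kappa> ne small]) blast+
  have "Z \<noteq> {}" using ultrafilter_obtain[OF D Z(2)] by blast
  then have "|A| ^c |Z| \<le>o |A| ^c \<kappa>"
    by (intro cexp_mono2' ordLess_imp_ordLeq Z(1) card_of_Card_order) (simp add: Field_card_of)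
  then have "|Func Z A| \<le>o |A|"
    unfolding cexp_def Field_card_of using FA by (rule ordLeq_transitive)
  then have "|ultrapower D A| \<le>o |A|"
    using ordLeq_transitive[OF card_of_ultrapower_le_Func[OF D ne Z(2) G]] by blast
  then show ?thesis unfolding A[symmetric] Field_card_of .
qed

section \<open>Ultrapowers of powers\<close>

text \<open>A function into \<open>\<nu> ^c l'\<close> is coded by the codes of its restrictions to
  all initial segments of \<open>l'\<close>. If \<open>f\<close> and \<open>g\<close> differ almost
  everywhere, a place of difference is a function into \<open>l'\<close>, hence bounded by some
  \<open>b\<close>, and the restrictions to the segment of \<open>b\<close> already differ.\<close>

lemma card_of_ultrapower_cexp_step:
  fixes D :: "'i filter" and l :: "'l rel" and l' :: "'m rel" and \<nu> :: "'n rel"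
  assumes D: "ultrafilter D" and l: "Cinfinite l" and l': "Cinfinite l'" and le: "l \<le>o l'"
    and under: "\<And>b. b \<in> Field l' \<Longrightarrow> |under l' b| \<le>o l"
    and nr: "\<And>h. \<not> unbounded_mod D l' h"
    and \<nu>: "Card_order \<nu>" "ctwo \<le>o \<nu>"
    and up: "|ultrapower D (Field (\<nu> ^c l))| \<le>o \<nu> ^c l"
  shows "|ultrapower D (Field (\<nu> ^c l'))| \<le>o \<nu> ^c l'"
proof -
  define A where "A b = Func (under l' b) (Field \<nu>)" for b
  define C where "C = Func (Field l) (Field \<nu>)"
  have C: "|C| = \<nu> ^c l" unfolding C_def cexp_def ..
  have "|ultrapower D (A b)| \<le>o |C|" if b: "b \<in> Field l'" for b
  proof (rule card_of_ultrapower_mono[OF D])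
    have "b \<in> under l' b" using Card_order_refl l' b unfolding under_def by fast
    then have "\<nu> ^c |under l' b| \<le>o \<nu> ^c l"
      by (intro cexp_mono2' under b \<nu>) (auto simp: Field_card_of)
    then show "|A b| \<le>o |C|" unfolding A_def C_def cexp_def Field_card_of .
    show "|ultrapower D C| \<le>o |C|" using up unfolding C[symmetric] Field_card_of .
  qed
  note le_C = this
  define code where "code b \<Phi> \<longleftrightarrow> (\<forall>f. range f \<subseteq> A b \<longrightarrow> \<Phi> f \<in> C) \<and>
     (\<forall>f g. range f \<subseteq> A b \<and> range g \<subseteq> A b \<and> \<Phi> f = \<Phi> g \<longrightarrow> (\<forall>\<^sub>F i in D. f i = g i))" for b \<Phi>
  have "\<exists>\<Phi>. code b \<Phi>" if "b \<in> Field l'" for b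
    unfolding code_def by (rule card_of_ultrapower_leE[OF D le_C[OF that]]) blast
  then obtain \<Phi> where "\<And>b. b \<in> Field l' \<Longrightarrow> code b (\<Phi> b)" by metis
  then have \<Phi>: "\<And>b f. b \<in> Field l' \<Longrightarrow> range f \<subseteq> A b \<Longrightarrow> \<Phi> b f \<in> C"
    "\<And>b f g. b \<in> Field l' \<Longrightarrow> range f \<subseteq> A b \<Longrightarrow> range g \<subseteq> A b \<Longrightarrow> \<Phi> b f = \<Phi> b g
       \<Longrightarrow> \<forall>\<^sub>F i in D. f i = g i"
    unfolding code_def by blast+
  define B where "B = Func (Field l') (Field \<nu>)"
  define res where "res b f i = (\<lambda>\<beta>. if \<beta> \<in> under l' b then f i \<beta> else undefined)"
    for b and f :: "'i \<Rightarrow> 'm \<Rightarrow> 'n" and i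
  have sub: "under l' b \<subseteq> Field l'" for b unfolding under_def Field_def by blast
  have res: "range (res b f) \<subseteq> A b" if "range f \<subseteq> B" for b f
  proof -
    have "f i \<beta> \<in> Field \<nu>" if "\<beta> \<in> Field l'" for i \<beta>
      using \<open>range f \<subseteq> B\<close> that unfolding B_def Func_def by blast
    then show ?thesis using sub[of b] unfolding res_def A_def Func_def by auto
  qed
  define \<Psi> where "\<Psi> f = (\<lambda>b. if b \<in> Field l' then \<Phi> b (res b f) else undefined)" for f
  have "|ultrapower D B| \<le>o |Func (Field l') C|"
  proof (rule card_of_ultrapower_leI[OF D, of B \<Psi>])
    show "\<Psi> f \<in> Func (Field l') C" if "range f \<subseteq> B" for f
      using \<Phi>(1) res[OF that] unfolding \<Psi>_def Func_def by simp
    fix f g assume fg: "range f \<subseteq> B" "range g \<subseteq> B" "\<Psi> f = \<Psi> g"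
    show "\<forall>\<^sub>F i in D. f i = g i"
    proof (rule ccontr)
      assume "\<not> ?thesis"
      then have ne: "\<forall>\<^sub>F i in D. f i \<noteq> g i" by (rule ultrafilter_not_eventually[OF D])
      have dif: "\<exists>\<xi>\<in>Field l'. f i \<noteq> g i \<longrightarrow> f i \<xi> \<noteq> g i \<xi>" for i
      proof (cases "f i = g i")
        case True
        have "Field l' \<noteq> {}" using l' unfolding cinfinite_def by auto
        then show ?thesis using True by blast
      next
        case False
        then obtain \<xi> where \<xi>: "f i \<xi> \<noteq> g i \<xi>" by blast
        have "f i \<in> B" "g i \<in> B" using fg by auto
        then have "\<xi> \<in> Field l'" using \<xi> unfolding B_def Func_def by force
        then show ?thesis using \<xi> by blast
      qed
      \<comment> \<open>A place where \<open>f i\<close> and \<open>g i\<close> differ, arbitrary if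
        they are equal.\<close>
      define h where "h i = (SOME \<xi>. \<xi> \<in> Field l' \<and> (f i \<noteq> g i \<longrightarrow> f i \<xi> \<noteq> g i \<xi>))" for i
      have h: "h i \<in> Field l' \<and> (f i \<noteq> g i \<longrightarrow> f i (h i) \<noteq> g i (h i))" for i
      proof -
        have "\<exists>\<xi>. \<xi> \<in> Field l' \<and> (f i \<noteq> g i \<longrightarrow> f i \<xi> \<noteq> g i \<xi>)" using dif[of i] by blast
        then show ?thesis unfolding h_def by (rule someI_ex)
      qed
      then have "range h \<subseteq> Field l'" by blast
      then obtain b where b: "b \<in> Field l'" "\<forall>\<^sub>F i in D. (h i, b) \<in> l' \<and> h i \<noteq> b"
        using bounded_mod[OF D _ _ nr] l' by blast
      have "\<Phi> b (res b f) = \<Phi> b (res b g)"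
        using fun_cong[OF fg(3), of b] b(1) unfolding \<Psi>_def by simp
      then have "\<forall>\<^sub>F i in D. res b f i = res b g i"
        by (rule \<Phi>(2)[OF b(1) res[OF fg(1)] res[OF fg(2)]])
      then obtain i where i: "res b f i = res b g i" "(h i, b) \<in> l'" "f i \<noteq> g i"
        using ultrafilter_obtain[OF D eventually_conj[OF eventually_conj[OF _ b(2)] ne]] by blast
      have "f i (h i) = g i (h i)"
        using fun_cong[OF i(1), of "h i"] i(2) unfolding res_def under_def by simp
      then show False using h i(3) by blast
    qed
  qed
  moreover have "|Func (Field l') C| \<le>o |B|"
  proof -
    \<comment> \<open>Sequences of \<open>l'\<close> codes cost nothing, because \<open>l\<close>
      times \<open>l'\<close> is \<open>l'\<close>.\<close>
    have "(\<nu> ^c l) ^c l' =o \<nu> ^c (l *c l')" by (rule cexp_cprod[OF \<nu>(1)])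
    also have "\<nu> ^c (l *c l') =o \<nu> ^c l'"
      using cexp_cong2[OF cprod_infinite2'[OF Cinfinite_Cnotzero[OF l] l' le] \<nu>(1) Card_order_cprod] .
    finally show ?thesis
      unfolding C[symmetric] B_def unfolding cexp_def Field_card_of by (rule ordIso_imp_ordLeq)
  qed
  ultimately have "|ultrapower D B| \<le>o |B|" by (rule ordLeq_transitive)
  then show ?thesis unfolding B_def cexp_def Field_card_of .
qed

section \<open>Transfer along isomorphism, power sets and beth numbers\<close>

lemma card_of_ultrapower_cong:
  assumes D: "ultrafilter D" and r: "Card_order r" and rs: "r =o s"
    and up: "|ultrapower D (Field r)| \<le>o r"
  shows "|ultrapower D (Field s)| \<le>o s"
proof -
  have s: "Card_order s" using Card_order_ordIso2[OF r rs] .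
  have "|Field s| \<le>o |Field r|"
    using card_of_mono2[OF ordIso_imp_ordLeq[OF ordIso_symmetric[OF rs]]] .
  moreover have "|ultrapower D (Field r)| \<le>o |Field s|"
    using ordLeq_ordIso_trans[OF up rs] unfolding ordLeq_card_of_Field_iff[OF s] .
  ultimately show ?thesis
    using card_of_ultrapower_mono[OF D] ordLeq_card_of_Field_iff[OF s] ordLeq_card_of_Field_iff[OF r] up 
    by metis
qed

text \<open>Elements of the ultrapower of \<open>Pow A\<close> act as internal subsets of the ultrapower of \<open>A\<close>.\<close>
lemma card_of_ultrapower_Pow:
  fixes D :: "'i filter" and A :: "'a set"
  assumes D: "ultrafilter D" and up: "|ultrapower D A| \<le>o |A|"
  shows "|ultrapower D (Pow A)| \<le>o |Pow A|"
proof -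
  obtain \<Phi> where \<Phi>: "\<And>f. range f \<subseteq> A \<Longrightarrow> \<Phi> f \<in> A"
    "\<And>f g. range f \<subseteq> A \<Longrightarrow> range g \<subseteq> A \<Longrightarrow> \<Phi> f = \<Phi> g \<Longrightarrow> \<forall>\<^sub>F i in D. f i = g i"
    using card_of_ultrapower_leE[OF D up] by blast
  \<comment> \<open>The internal set given by \<open>f\<close>, as a set of codes of its
    members.\<close>
  define S where "S f = {\<Phi> g |g. range g \<subseteq> A \<and> (\<forall>\<^sub>F i in D. g i \<in> f i)}" for f
  have sub: "\<forall>\<^sub>F i in D. f i \<subseteq> f' i" if f: "range f \<subseteq> Pow A" and S: "S f \<subseteq> S f'" for f f'
  proof (rule ccontr)
    assume "\<not> ?thesis"
    then have ne: "\<forall>\<^sub>F i in D. \<not> f i \<subseteq> f' i" by (rule ultrafilter_not_eventually[OF D])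
    then obtain i0 where "\<not> f i0 \<subseteq> f' i0" using ultrafilter_obtain[OF D] by blast
    then obtain x0 where x0: "x0 \<in> A" using f by blast
    \<comment> \<open>A witness against inclusion at each \<open>i\<close>; its class belongs to the
      internal set of \<open>f\<close> but not to that of \<open>f'\<close>. The value
      \<open>x0\<close> only keeps the range inside \<open>A\<close>.\<close>
    define g where "g i = (if f i \<subseteq> f' i then x0 else SOME x. x \<in> f i - f' i)" for i
    have g: "g i \<in> f i - f' i" if "\<not> f i \<subseteq> f' i" for i
    proof -
      have "\<exists>x. x \<in> f i - f' i" using that by blast
      then have "(SOME x. x \<in> f i - f' i) \<in> f i - f' i" by (rule someI_ex)
      then show ?thesis using that unfolding g_def by simp
    qed
    have "g i \<in> A" for i
    proof (cases "f i \<subseteq> f' i")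
      case True
      then show ?thesis using x0 unfolding g_def by simp
    next
      case False
      then show ?thesis using g[OF False] f by blast
    qed
    then have gA: "range g \<subseteq> A" by blast
    have "\<forall>\<^sub>F i in D. g i \<in> f i" using ne by (rule eventually_mono) (use g in blast)
    then have "\<Phi> g \<in> S f'" using gA S unfolding S_def by blast
    then obtain g' where g': "range g' \<subseteq> A" "\<Phi> g = \<Phi> g'" "\<forall>\<^sub>F i in D. g' i \<in> f' i"
      unfolding S_def by blast
    have "\<forall>\<^sub>F i in D. g i = g' i" using \<Phi>(2)[OF gA g'(1,2)] .
    then obtain i where "g i = g' i" "g' i \<in> f' i" "\<not> f i \<subseteq> f' i"
      using ultrafilter_obtain[OF D eventually_conj[OF eventually_conj[OF _ g'(3)] ne]] by blast
    then show False using g[of i] by simp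
  qed
  show ?thesis
  proof (rule card_of_ultrapower_leI[OF D, of _ S])
    show "S f \<in> Pow A" for f using \<Phi>(1) unfolding S_def by blast
    fix f g assume fg: "range f \<subseteq> Pow A" "range g \<subseteq> Pow A" "S f = S g"
    have "\<forall>\<^sub>F i in D. f i \<subseteq> g i" "\<forall>\<^sub>F i in D. g i \<subseteq> f i" using sub fg by auto
    then show "\<forall>\<^sub>F i in D. f i = g i" by eventually_elim auto
  qed
qed

lemma card_of_ultrapower_ctwo_cexp:
  assumes D: "ultrafilter D" and r: "Card_order r" and up: "|ultrapower D (Field r)| \<le>o r"
  shows "|ultrapower D (Field (ctwo ^c r))| \<le>o ctwo ^c r"
proof -
  have iso: "|Pow (Field r)| =o ctwo ^c r"
    unfolding cexp_def ctwo_def Field_card_of by (rule card_of_Pow_Func)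
  have "|ultrapower D (Field |Pow (Field r)| )| \<le>o |Pow (Field r)|"
    unfolding Field_card_of using card_of_ultrapower_Pow[OF D] up ordLeq_card_of_Field_iff[OF r] by blast
  then show ?thesis using card_of_ultrapower_cong[OF D card_of_Card_order iso] by simp
qed

lemma card_of_ultrapower_is_beth:
  fixes b :: "'b rel"
  assumes D: "ultrafilter D" and l: "Card_order l" and up: "|ultrapower D (Field l)| \<le>o l"
  shows "is_beth l m b \<Longrightarrow> |ultrapower D (Field b)| \<le>o b"
proof (induction m arbitrary: b)
  case 0
  then have "l =o b" by (simp add: ordIso_symmetric)
  then show ?case by (rule card_of_ultrapower_cong[OF D l _ up])
next
  case (Suc m)
  then obtain b' :: "'b rel" where b': "is_beth l m b'" "b =o ctwo ^c b'" by auto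
  have "Card_order b'" using b'(1) by (cases m) auto
  then have "|ultrapower D (Field (ctwo ^c b'))| \<le>o ctwo ^c b'"
    using card_of_ultrapower_ctwo_cexp[OF D] Suc.IH[OF b'(1)] by blast
  then show ?case
    using card_of_ultrapower_cong[OF D Card_order_cexp ordIso_symmetric[OF b'(2)]] by blast
qed

section \<open>Descent from successor cardinals, and cofinality\<close>

text \<open>Given \<open>f\<close> unbounded in \<open>l'\<close> and injections \<open>e \<beta>\<close> of the initial segments of \<open>l'\<close> into \<open>l\<close>,
  look at the functions \<open>i \<mapsto> e (f i) \<alpha>\<close>: if each is bounded in \<open>l\<close>, then \<open>l'\<close> many of
  them have a common bound.\<close>
lemma regular_cardSuc_cases:
  fixes D :: "'i filter" and l :: "'l rel" and l' :: "'m rel"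
  assumes D: "ultrafilter D" and l: "Cinfinite l" and l': "l' =o cardSuc l" and reg: "regular D l' l'"
  obtains (unbounded) h where "unbounded_mod D l h"
  | (few) c S X where "c \<in> Field l" "infinite (underS l c)" "l' \<le>o |S|"
      "\<And>s :: 'm. s \<in> S \<Longrightarrow> \<forall>\<^sub>F i in D. i \<in> X s"
      "\<And>i. |{s\<in>S. i \<in> X s}| \<le>o |underS l c|"
proof (cases "\<exists>h. unbounded_mod D l h")
  case True
  then show thesis using unbounded by blast
next
  case False
  have L': "Cinfinite l'" using Cinfinite_cong[OF ordIso_symmetric[OF l'] Cinfinite_cardSuc[OF l]] .
  have le_l: "|A| \<le>o l" if "|A| <o l'" for A :: "'m set"
    using cardSuc_ordLeq_ordLess[of l "|A|"] l card_of_Card_order ordLess_ordIso_trans[OF that l'] by blast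
  have "regularCard l'"
    using regularCard_ordIso[OF ordIso_symmetric[OF l'] Cinfinite_cardSuc[OF l] regularCard_cardSuc[OF l]] .
  then obtain f where f: "unbounded_mod D l' f" using regular_imp_unbounded[OF reg] by blast
  have fF: "f i \<in> Field l'" for i using f unfolding unbounded_mod_def by blast
  have "\<exists>e. inj_on e (under l' b) \<and> e ` under l' b \<subseteq> Field l"
    if "b \<in> Field l'" for b
  proof -
    have "|under l' b| \<le>o |Field l|"
      using le_l[OF card_of_under[OF L' that]] ordLeq_card_of_Field_iff l by blast
    then show ?thesis unfolding card_of_ordLeq .
  qed
  then obtain e where e: "\<And>b. b \<in> Field l' \<Longrightarrow> inj_on (e b) (under l' b)"
    "\<And>b. b \<in> Field l' \<Longrightarrow> e b ` under l' b \<subseteq> Field l"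
    by metis
  have "Field l \<noteq> {}" using l unfolding cinfinite_def by auto
  then obtain c0 where c0: "c0 \<in> Field l" by blast
  \<comment> \<open>The place of \<open>a\<close> in the enumeration of the segment below
    \<open>f i\<close>. The default \<open>c0\<close> is used only off a set of \<open>D\<close>
    when \<open>a \<in> Field l'\<close>.\<close>
  define h where "h a i = (if (a, f i) \<in> l' then e (f i) a else c0)" for a i
  have hF: "range (h a) \<subseteq> Field l" for a
    using e(2)[OF fF] c0 unfolding h_def under_def by auto
  have "\<exists>c. c \<in> Field l \<and> (\<forall>\<^sub>F i in D. (h a i, c) \<in> l \<and> h a i \<noteq> c)" for a
  proof -
    have "\<not> unbounded_mod D l (h a)" using False by blast
    then show ?thesis by (rule bounded_mod[OF D l[THEN conjunct2] hF]) blast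
  qed
  then have "\<forall>a. \<exists>c. c \<in> Field l \<and> (\<forall>\<^sub>F i in D. (h a i, c) \<in> l \<and> h a i \<noteq> c)" ..
  then obtain g where "\<forall>a. g a \<in> Field l \<and> (\<forall>\<^sub>F i in D. (h a i, g a) \<in> l \<and> h a i \<noteq> g a)"
    by (rule choice[THEN exE])
  then have g: "\<And>a. g a \<in> Field l" "\<And>a. \<forall>\<^sub>F i in D. (h a i, g a) \<in> l \<and> h a i \<noteq> g a"
    by simp_all
  define S where "S c = {a\<in>Field l'. g a = c}" for c
  \<comment> \<open>Pigeonhole: \<open>Field l'\<close> is not a union of \<open>l\<close> sets of
    size at most \<open>l\<close>, so \<open>l'\<close> many indices share a bound
    \<open>c\<close>.\<close>
  have "\<exists>c\<in>Field l. l' \<le>o |S c|"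
  proof (rule ccontr)
    assume n: "\<not> ?thesis"
    have "|S c| \<le>o l" if "c \<in> Field l" for c
      using n that Card_order_ordLess_or_ordLeq[OF card_of_Card_order L'[THEN conjunct2], of "S c"] le_l
      by blast
    then have "|\<Union>c\<in>Field l. S c| \<le>o l"
      using UNION_Cinfinite_bound[of "Field l" l S] l card_of_Field_ordIso ordIso_imp_ordLeq by blast
    moreover have "(\<Union>c\<in>Field l. S c) = Field l'" using g(1) unfolding S_def by blast
    ultimately have "|Field l'| \<le>o l" by simp
    then have "l' \<le>o l"
      using ordIso_ordLeq_trans[OF ordIso_symmetric[OF card_of_Field_ordIso]] L' by blast
    then have "cardSuc l \<le>o l" using ordIso_ordLeq_trans[OF ordIso_symmetric[OF l']] by blast
    then show False using cardSuc_greater not_ordLess_ordLeq l by blast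
  qed
  then obtain c where c: "c \<in> Field l" "l' \<le>o |S c|" by blast
  define X where "X a = {i. (a, f i) \<in> l' \<and> h a i \<in> underS l c}" for a
  have evX: "\<forall>\<^sub>F i in D. i \<in> X a" if "a \<in> S c" for a
  proof -
    have a: "a \<in> Field l'" "g a = c" using that unfolding S_def by blast+
    have "\<forall>\<^sub>F i in D. (a, f i) \<in> l'" using f a(1) unfolding unbounded_mod_def by blast
    then show ?thesis
      using g(2)[of a] by eventually_elim (simp add: X_def a(2) underS_def)
  qed
  \<comment> \<open>For fixed \<open>i\<close> the injection \<open>e (f i)\<close> sends the
    indices of \<open>i\<close> below \<open>c\<close>.\<close>
  have few': "|{s\<in>S c. i \<in> X s}| \<le>o |underS l c|" for i
  proof (rule card_of_ordLeqI)
    show "inj_on (e (f i)) {s\<in>S c. i \<in> X s}"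
      using e(1)[OF fF[of i]] by (rule inj_on_subset) (auto simp: X_def under_def)
    show "e (f i) s \<in> underS l c" if "s \<in> {s\<in>S c. i \<in> X s}" for s
      using that unfolding X_def h_def by auto
  qed
  \<comment> \<open>If finite, one more set \<open>X a\<close> than \<open>underS l c\<close> has
    elements would still have a common point, contrary to \<open>few'\<close>.\<close>
  have "infinite (underS l c)"
  proof
    assume fin: "finite (underS l c)"
    have "infinite (S c)" using cinfinite_mono[OF c(2)] L' unfolding cinfinite_def Field_card_of by blast
    then obtain T where T: "T \<subseteq> S c" "finite T" "card T = Suc (card (underS l c))"
      using infinite_arbitrarily_large by blast
    have "\<forall>\<^sub>F i in D. \<forall>a\<in>T. i \<in> X a"
      using T(1) evX by (intro eventually_ball_finite T(2)) blast
    then obtain i where i: "\<forall>a\<in>T. i \<in> X a" using ultrafilter_obtain[OF D] by blast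
    have "T \<subseteq> {s\<in>S c. i \<in> X s}" using i T(1) by blast
    then have "|T| \<le>o |underS l c|" using ordLeq_transitive[OF card_of_mono1 few'] by blast
    then obtain k where "inj_on k T" "k ` T \<subseteq> underS l c"
      unfolding card_of_ordLeq[symmetric] by blast
    then have "card T \<le> card (underS l c)" using card_inj_on_le fin by blast
    then show False using T(3) by simp
  qed
  then show thesis using few[OF c(1) _ c(2) evX few'] by blast
qed

text \<open>In the second case each point has at most \<open>|underS l c|\<close> indices, fewer
  than \<open>l\<close>, out of at least \<open>l\<close> indices.\<close>

lemma regular_cardSuc_imp_regular:
  assumes D: "ultrafilter D" and l: "Cinfinite l" and l': "l' =o cardSuc l" and reg: "regular D l' l'"
  shows "regular D l l"
  using assms
proof (cases rule: regular_cardSuc_cases)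
  case (unbounded h)
  then show ?thesis using unbounded_imp_regular l by blast
next
  case (few c S X)
  have "l \<le>o l'"
    using ordLeq_ordIso_trans[OF cardSuc_ordLeq ordIso_symmetric[OF l']] l by blast
  then have "l \<le>o |S|" using few(3) by (rule ordLeq_transitive)
  moreover have "|{s\<in>S. i \<in> X s}| <o l" for i
    using ordLeq_ordLess_trans[OF few(5) card_of_underS] l few(1) by blast
  ultimately show ?thesis using few(4) by (intro regularI[OF l])
qed

lemma is_csuc_iter_Cinfinite:
  fixes l :: "'l rel"
  assumes "Cinfinite \<kappa>"
  shows "is_csuc_iter \<kappa> n l \<Longrightarrow> Cinfinite l \<and> \<kappa> \<le>o l"
proof (induction n arbitrary: l)
  case 0
  then have "\<kappa> =o l" by (simp add: ordIso_symmetric)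
  then show ?case using Cinfinite_cong assms ordIso_imp_ordLeq by blast
next
  case (Suc n)
  then obtain l' :: "'l rel" where l': "is_csuc_iter \<kappa> n l'" "l =o cardSuc l'" by auto
  have i: "Cinfinite l'" "\<kappa> \<le>o l'" using Suc.IH[OF l'(1)] by blast+
  have "l' \<le>o l" using ordLeq_ordIso_trans[OF cardSuc_ordLeq ordIso_symmetric[OF l'(2)]] i(1) by blast
  then show ?case
    using ordLeq_transitive[OF i(2)] Cinfinite_cong[OF ordIso_symmetric[OF l'(2)] Cinfinite_cardSuc[OF i(1)]]
    by blast
qed

lemma is_csuc_iter_regular:
  fixes l :: "'l rel"
  assumes D: "ultrafilter D" and \<kappa>: "Cinfinite \<kappa>"
  shows "is_csuc_iter \<kappa> n l \<Longrightarrow> regular D l l \<Longrightarrow> regular D \<kappa> \<kappa>"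
proof (induction n arbitrary: l)
  case 0
  then have "l =o \<kappa>" by simp
  then show ?case by (rule regular_cong[OF 0(2)])
next
  case (Suc n)
  then obtain l' :: "'l rel" where l': "is_csuc_iter \<kappa> n l'" "l =o cardSuc l'" by auto
  have "regular D l' l'"
    using regular_cardSuc_imp_regular[OF D _ l'(2) Suc.prems(2)] is_csuc_iter_Cinfinite[OF \<kappa> l'(1)] by blast
  then show ?case by (rule Suc.IH[OF l'(1)])
qed

text \<open>The descent stops at the successor of \<open>\<kappa>\<close>, which is a regular
  cardinal even if \<open>\<kappa>\<close> is singular, so that regularity of \<open>D\<close> there
  yields decomposability.\<close>

lemma is_csuc_iter_regular_cardSuc:
  fixes l :: "'l rel"
  assumes D: "ultrafilter D" and \<kappa>: "Cinfinite \<kappa>"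
  shows "is_csuc_iter \<kappa> (Suc n) l \<Longrightarrow> regular D l l \<Longrightarrow> regular D (cardSuc \<kappa>) (cardSuc \<kappa>)"
proof (induction n arbitrary: l)
  case 0
  then obtain l' :: "'l rel" where l': "Card_order l'" "l' =o \<kappa>" "l =o cardSuc l'" by auto
  have "cardSuc l' =o cardSuc \<kappa>" using cardSuc_invar_ordIso l'(1,2) \<kappa> by blast
  then have "l =o cardSuc \<kappa>" using ordIso_transitive[OF l'(3)] by blast
  then show ?case using regular_cong[OF 0(2)] by blast
next
  case (Suc n)
  then obtain l' :: "'l rel" where l': "is_csuc_iter \<kappa> (Suc n) l'" "l =o cardSuc l'"
    unfolding is_csuc_iter.simps(2)[of \<kappa> "Suc n"] by blast
  have "regular D l' l'"
    using regular_cardSuc_imp_regular[OF D _ l'(2) Suc.prems(2)] is_csuc_iter_Cinfinite[OF \<kappa> l'(1)] by blast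
  then show ?case by (rule Suc.IH[OF l'(1)])
qed

text \<open>A cardinal between \<open>\<kappa>\<close> and its \<open>p\<close>-th successor is
  itself an iterated successor of \<open>\<kappa>\<close>, from which regularity descends.\<close>

lemma is_csuc_iter_between_regular:
  fixes l :: "'l rel"
  assumes D: "ultrafilter D" and \<kappa>: "Cinfinite \<kappa>" and \<mu>: "\<kappa> \<le>o \<mu>" "regular D \<mu> \<mu>"
  shows "is_csuc_iter \<kappa> p l \<Longrightarrow> \<mu> \<le>o l \<Longrightarrow> regular D \<kappa> \<kappa>"
proof (induction p arbitrary: l)
  case 0
  then have "\<mu> \<le>o \<kappa>" using ordLeq_ordIso_trans by auto
  then have "\<mu> =o \<kappa>" using \<mu>(1) ordIso_iff_ordLeq by blast
  then show ?case by (rule regular_cong[OF \<mu>(2)])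
next
  case (Suc p)
  then obtain l' :: "'l rel" where l': "is_csuc_iter \<kappa> p l'" "l =o cardSuc l'" by auto
  have c: "Card_order \<mu>" "Card_order l'"
    using regular_Cinfinite[OF \<mu>(2)] is_csuc_iter_Cinfinite[OF \<kappa> l'(1)] by blast+
  show ?case
  proof (cases "\<mu> \<le>o l'")
    case True
    then show ?thesis by (rule Suc.IH[OF l'(1)])
  next
    case False
    then have "l' <o \<mu>" using Card_order_ordLess_or_ordLeq[OF c(2,1)] by blast
    then have "l \<le>o \<mu>" using ordIso_ordLeq_trans[OF l'(2) cardSuc_least[OF c(2,1)]] by blast
    then have "\<mu> =o l" using Suc.prems(2) ordIso_iff_ordLeq by blast
    then have "regular D l l" by (rule regular_cong[OF \<mu>(2)])
    then show ?thesis by (rule is_csuc_iter_regular[OF D \<kappa> Suc.prems(1)])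
  qed
qed

text \<open>Replacing \<open>h i\<close> by an element above it in a cofinal set \<open>A\<close> of
  least size gives a function unbounded in the cardinal \<open>|A|\<close>, provided that element is
  chosen least in the order \<open>|A|\<close>.\<close>

lemma unbounded_imp_regular_cf:
  fixes D :: "'i filter" and \<kappa> :: "'k rel"
  assumes D: "ultrafilter D" and \<kappa>: "Cinfinite \<kappa>" and h: "unbounded_mod D \<kappa> h"
  shows "regular D (cf \<kappa>) (cf \<kappa>)"
proof -
  \<comment> \<open>The property from which \<open>cf\<close> chooses; a set with it must first be
    shown to exist.\<close>
  define good where "good A \<longleftrightarrow> A \<subseteq> Field \<kappa> \<and> cofinal A \<kappa> \<and>
    (\<forall>B. B \<subseteq> Field \<kappa> \<and> cofinal B \<kappa> \<longrightarrow> |A| \<le>o |B| )" for A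
  define R where "R = {|A| |A. A \<subseteq> Field \<kappa> \<and> cofinal A \<kappa>}"
  have "cofinal (Field \<kappa>) \<kappa>"
    using infinite_Card_order_limit \<kappa> unfolding cofinal_def cinfinite_def by metis
  then have "R \<noteq> {}" unfolding R_def by blast
  moreover have "\<forall>r\<in>R. Card_order r" using card_of_Card_order unfolding R_def by blast
  ultimately have "\<exists>r\<in>R. \<forall>r'\<in>R. r \<le>o r'" by (rule exists_minim_Card_order)
  then have "\<exists>A. good A" unfolding R_def good_def by blast
  then have "good (SOME A. good A)" by (rule someI_ex)
  then obtain A where A: "A \<subseteq> Field \<kappa>" "cofinal A \<kappa>"
    and min: "\<And>B. B \<subseteq> Field \<kappa> \<Longrightarrow> cofinal B \<kappa> \<Longrightarrow> |A| \<le>o |B|" and cf: "cf \<kappa> = |A|"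
    unfolding cf_def good_def by blast
  have hF: "h i \<in> Field \<kappa>" for i using h unfolding unbounded_mod_def by blast
  have "infinite A"
  proof
    assume fin: "finite A"
    have "\<exists>a\<in>Field \<kappa>. \<forall>b\<in>A. (b, a) \<in> \<kappa>"
      using fin A(1)
    proof (induction rule: finite_induct)
      case empty
      have "Field \<kappa> \<noteq> {}" using \<kappa> unfolding cinfinite_def by auto
      then show ?case by blast
    next
      case (insert x B)
      then obtain a where a: "a \<in> Field \<kappa>" "\<forall>b\<in>B. (b, a) \<in> \<kappa>" by blast
      show ?case
      proof (cases "(x, a) \<in> \<kappa>")
        case True
        then show ?thesis using a by blast
      next
        case False
        have x: "x \<in> Field \<kappa>" using insert.prems by blast
        have "(a, x) \<in> \<kappa>" using Card_order_linear(1)[OF _ x a(1) False] \<kappa> by blast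
        then have "\<forall>b\<in>B. (b, x) \<in> \<kappa>" using a(2) Card_order_transD \<kappa> by metis
        then show ?thesis using x Card_order_refl \<kappa> by (metis insertE)
      qed
    qed
    then obtain a where a: "a \<in> Field \<kappa>" "\<forall>b\<in>A. (b, a) \<in> \<kappa>" by blast
    then obtain b where "b \<in> A" "a \<noteq> b" "(a, b) \<in> \<kappa>" using A(2) unfolding cofinal_def by blast
    then show False using a(2) Card_order_antisym \<kappa> by metis
  qed
  then have cA: "Cinfinite |A|" by (simp add: cinfinite_def Field_card_of card_of_card_order_on)
  have wo: "wo_rel |A|" using Card_order_wo_rel[OF card_of_Card_order] .
  \<comment> \<open>Candidates above \<open>h i\<close> in the order \<open>\<kappa>\<close>;
    \<open>g\<close> minimises over them in \<open>|A|\<close>, an order that need not agree with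
    \<open>\<kappa>\<close>.\<close>
  define E where "E i = {a\<in>A. (h i, a) \<in> \<kappa> \<and> h i \<noteq> a}" for i
  define g where "g i = wo_rel.minim |A| (E i)" for i
  have E: "E i \<subseteq> Field |A|" "E i \<noteq> {}" for i
    using hF[of i] A(2) unfolding E_def cofinal_def Field_card_of by auto
  have gE: "g i \<in> E i" for i unfolding g_def using wo_rel.minim_in[OF wo E] .
  have gm: "(g i, a) \<in> |A|" if "a \<in> E i" for i a
    unfolding g_def using wo_rel.minim_least[OF wo E(1) that] .
  have "unbounded_mod D |A| g"
    unfolding unbounded_mod_def
  proof (intro conjI ballI)
    show "range g \<subseteq> Field |A|" using gE E(1) by blast
    fix a assume a: "a \<in> Field |A|"
    have aA: "a \<in> A" using a unfolding Field_card_of .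
    \<comment> \<open>\<open>B\<close> is smaller than \<open>A\<close>, hence not cofinal: no
      element of it is strictly above some \<open>c\<close>. Once \<open>h i\<close> is at least
      \<open>c\<close>, the element \<open>g i\<close>, strictly above \<open>h i\<close>, is not in
      \<open>B\<close>.\<close>
    define B where "B = underS |A| a"
    have BA: "B \<subseteq> A" unfolding B_def underS_def using Field_card_of[of A] FieldI1 by fastforce
    have "|B| <o |A|" unfolding B_def by (rule card_of_underS[OF card_of_Card_order a])
    then have "\<not> cofinal B \<kappa>" using min[of B] BA A(1) not_ordLess_ordLeq by blast
    then obtain c where c: "c \<in> Field \<kappa>" "\<And>b. b \<in> B \<Longrightarrow> c = b \<or> (c, b) \<notin> \<kappa>"
      unfolding cofinal_def by blast
    have "\<forall>\<^sub>F i in D. (c, h i) \<in> \<kappa>" using h c(1) unfolding unbounded_mod_def by blast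
    moreover have "(a, g i) \<in> |A|" if ch: "(c, h i) \<in> \<kappa>" for i
    proof (rule ccontr)
      assume "(a, g i) \<notin> |A|"
      moreover have "g i \<in> Field |A|" using gE E(1) by blast
      ultimately have "g i \<in> B"
        using Card_order_linear[OF card_of_Card_order a, of "g i"] unfolding B_def underS_def by blast
      moreover have g: "(h i, g i) \<in> \<kappa>" "h i \<noteq> g i" using gE[of i] unfolding E_def by blast+
      have "(c, g i) \<in> \<kappa>" using Card_order_transD ch g(1) \<kappa> by metis
      ultimately have "c = g i" using c(2) by blast
      then show False using ch g Card_order_antisym \<kappa> by metis
    qed
    ultimately show "\<forall>\<^sub>F i in D. (a, g i) \<in> |A|" by (rule eventually_mono)
  qed
  then show ?thesis unfolding cf using unbounded_imp_regular[OF cA] by blast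
qed

section \<open>Iterated successors and strong limits\<close>

text \<open>A function unbounded in a proper iterated successor would make \<open>D\<close> regular,
  thus decomposable, at the successor of \<open>\<kappa>\<close>. That cardinal is at most
  \<open>\<nu> ^c \<kappa>\<close>, so this is excluded and the power step applies.\<close>

lemma card_of_ultrapower_cexp_csuc_iter:
  fixes D :: "'i filter" and \<kappa> :: "'k rel" and \<nu> :: "'n rel" and l :: "'l rel"
  assumes D: "ultrafilter D" and \<kappa>: "Cinfinite \<kappa>" and \<nu>: "Card_order \<nu>" "ctwo \<le>o \<nu>"
    and nd: "\<And>\<mu> :: ('k \<Rightarrow> 'n) rel. Card_order \<mu> \<Longrightarrow> \<kappa> \<le>o \<mu> \<Longrightarrow> \<mu> \<le>o \<nu> ^c \<kappa> \<Longrightarrow> \<not> decomposable D \<mu>"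
  shows "is_csuc_iter \<kappa> n l \<Longrightarrow> |ultrapower D (Field (\<nu> ^c l))| \<le>o \<nu> ^c l"
proof (induction n arbitrary: l)
  case 0
  then have l: "Card_order l" "l =o \<kappa>" by simp_all
  have "\<nu> ^c \<kappa> =o \<nu> ^c l"
    using cexp_cong2[OF l(2) \<nu>(1) l(1)] by (rule ordIso_symmetric)
  then show ?case by (rule card_of_ultrapower_cong[OF D Card_order_cexp _ card_of_ultrapower_cexp[OF D \<kappa> \<nu> nd]])
next
  case (Suc n)
  then obtain l' :: "'l rel" where l': "is_csuc_iter \<kappa> n l'" "l =o cardSuc l'" by auto
  have c': "Cinfinite l'" using is_csuc_iter_Cinfinite[OF \<kappa> l'(1)] by blast
  have c: "Cinfinite l" using is_csuc_iter_Cinfinite[OF \<kappa> Suc.prems] by blast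
  have nr: "\<not> regular D (cardSuc \<kappa>) (cardSuc \<kappa>)"
  proof
    assume "regular D (cardSuc \<kappa>) (cardSuc \<kappa>)"
    then have dec: "decomposable D (cardSuc \<kappa>)"
      by (rule regular_imp_decomposable[OF D _ regularCard_cardSuc[OF \<kappa>]])
    have "\<kappa> <o \<nu> ^c \<kappa>"
      using ordLess_ordLeq_trans[OF ordLess_ctwo_cexp cexp_mono1[OF \<nu>(2)]] \<kappa> by blast
    then have le: "cardSuc \<kappa> \<le>o \<nu> ^c \<kappa>" using cardSuc_least Card_order_cexp \<kappa> by blast
    obtain \<mu> :: "('k \<Rightarrow> 'n) rel" where \<mu>: "Card_order \<mu>" "cardSuc \<kappa> =o \<mu>"
      using exists_Card_order_ordIso[OF le cardSuc_Card_order] \<kappa> by blast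
    have "\<kappa> \<le>o \<mu>" using ordLeq_ordIso_trans[OF cardSuc_ordLeq \<mu>(2)] \<kappa> by blast
    moreover have "\<mu> \<le>o \<nu> ^c \<kappa>" using ordIso_ordLeq_trans[OF ordIso_symmetric[OF \<mu>(2)] le] .
    ultimately show False using nd[OF \<mu>(1)] decomposable_cong[OF dec \<mu>(2)] by simp
  qed
  have nu: "\<not> unbounded_mod D l h" for h
    using is_csuc_iter_regular_cardSuc[OF D \<kappa> Suc.prems unbounded_imp_regular[OF c]] nr by blast
  have le: "l' \<le>o l"
    using ordLeq_ordIso_trans[OF cardSuc_ordLeq ordIso_symmetric[OF l'(2)]] c' by blast
  have under: "|under l b| \<le>o l'" if "b \<in> Field l" for b
    using cardSuc_ordLeq_ordLess[of l' "|under l b|"] c' card_of_Card_order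
      ordLess_ordIso_trans[OF card_of_under[OF c that] l'(2)] by blast
  show ?case
    by (rule card_of_ultrapower_cexp_step[OF D c' c le under nu \<nu> Suc.IH[OF l'(1)]])
qed

text \<open>Initial segments of each successor have at most the size of its predecessor, so the
  bound climbs as long as no function is unbounded.\<close>

lemma card_of_ultrapower_csuc_iter:
  fixes D :: "'i filter" and \<kappa> :: "'k rel" and l :: "'l rel"
  assumes D: "ultrafilter D" and \<kappa>: "Cinfinite \<kappa>" and up: "|ultrapower D (Field \<kappa>)| \<le>o \<kappa>"
    and nr: "\<not> regular D (cardSuc \<kappa>) (cardSuc \<kappa>)"
  shows "is_csuc_iter \<kappa> n l \<Longrightarrow> |ultrapower D (Field l)| \<le>o l"
proof (induction n arbitrary: l)
  case 0
  then have "\<kappa> =o l" by (simp add: ordIso_symmetric)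
  then show ?case using card_of_ultrapower_cong[OF D _ _ up] \<kappa> by blast
next
  case (Suc n)
  then obtain l' :: "'l rel" where l': "is_csuc_iter \<kappa> n l'" "l =o cardSuc l'" by auto
  have c': "Cinfinite l'" using is_csuc_iter_Cinfinite[OF \<kappa> l'(1)] by blast
  have c: "Cinfinite l" using is_csuc_iter_Cinfinite[OF \<kappa> Suc.prems] by blast
  have nu: "\<not> unbounded_mod D l h" for h
    using is_csuc_iter_regular_cardSuc[OF D \<kappa> Suc.prems unbounded_imp_regular[OF c]] nr by blast
  have le: "l' \<le>o l"
    using ordLeq_ordIso_trans[OF cardSuc_ordLeq ordIso_symmetric[OF l'(2)]] c' by blast
  show ?case
  proof (rule bounded_card_of_ultrapower[OF D c nu])
    fix b assume b: "b \<in> Field l"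
    have "|under l b| \<le>o l'"
      using cardSuc_ordLeq_ordLess[of l' "|under l b|"] c' card_of_Card_order
        ordLess_ordIso_trans[OF card_of_under[OF c b] l'(2)] by blast
    then have "|under l b| \<le>o |Field l'|" using ordLeq_card_of_Field_iff c' by blast
    moreover have "|ultrapower D (Field l')| \<le>o |Field l'|"
      using Suc.IH[OF l'(1)] ordLeq_card_of_Field_iff c' by blast
    ultimately have "|ultrapower D (under l b)| \<le>o |Field l'|"
      by (rule card_of_ultrapower_mono[OF D])
    then have "|ultrapower D (under l b)| \<le>o l'" using ordLeq_card_of_Field_iff c' by blast
    then show "|ultrapower D (under l b)| \<le>o l" using le by (rule ordLeq_transitive)
  qed
qed

text \<open>An ultrafilter selects one of finitely many fibres, so each function is constant almost
  everywhere.\<close>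

lemma finite_card_of_ultrapower:
  fixes D :: "'i filter"
  assumes D: "ultrafilter D" and A: "finite A"
  shows "|ultrapower D A| \<le>o |A|"
proof -
  have ex: "\<exists>c. c \<in> A \<and> (\<forall>\<^sub>F i in D. f i = c)" if f: "range f \<subseteq> A" for f :: "'i \<Rightarrow> 'a"
  proof (rule ccontr)
    assume "\<not> ?thesis"
    then have "\<forall>c\<in>A. \<forall>\<^sub>F i in D. f i \<noteq> c" using ultrafilter_not_eventually[OF D] by blast
    then have "\<forall>\<^sub>F i in D. \<forall>c\<in>A. f i \<noteq> c" by (rule eventually_ball_finite[OF A])
    then obtain i where "\<forall>c\<in>A. f i \<noteq> c" using ultrafilter_obtain[OF D] by blast
    then show False using f by blast
  qed
  define \<Phi> where "\<Phi> f = (SOME c. c \<in> A \<and> (\<forall>\<^sub>F i in D. f i = c))" for f :: "'i \<Rightarrow> 'a"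
  have \<Phi>: "\<Phi> f \<in> A \<and> (\<forall>\<^sub>F i in D. f i = \<Phi> f)" if "range f \<subseteq> A" for f
    unfolding \<Phi>_def by (rule someI_ex[OF ex[OF that]])
  show ?thesis
  proof (rule card_of_ultrapower_leI[OF D, of A \<Phi>])
    show "\<Phi> f \<in> A" if "range f \<subseteq> A" for f using \<Phi>[OF that] by blast
    fix f g :: "'i \<Rightarrow> 'a" assume fg: "range f \<subseteq> A" "range g \<subseteq> A" "\<Phi> f = \<Phi> g"
    have "\<forall>\<^sub>F i in D. f i = \<Phi> f" "\<forall>\<^sub>F i in D. g i = \<Phi> g" using \<Phi> fg(1,2) by blast+
    then show "\<forall>\<^sub>F i in D. f i = g i" by eventually_elim (simp add: fg(3))
  qed
qed

section \<open>Strong limit cardinals\<close>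

lemma strong_limit_ctwo_cexp:
  fixes \<kappa> :: "'k rel"
  assumes sl: "strong_limit \<kappa>" and r: "Card_order r" "r <o \<kappa>"
  shows "ctwo ^c r <o \<kappa>"
proof -
  obtain r' :: "'k rel" where r': "Card_order r'" "r =o r'"
    using exists_Card_order_ordIso[OF ordLess_imp_ordLeq[OF r(2)] r(1)] by blast
  have "r' <o \<kappa>" using ordIso_ordLess_trans[OF ordIso_symmetric[OF r'(2)] r(2)] .
  then have "ctwo ^c r' <o \<kappa>" using sl r'(1) unfolding strong_limit_def by blast
  then show ?thesis
    using ordIso_ordLess_trans[OF cexp_cong2[OF r'(2) Card_order_ctwo r(1)]] by blast
qed

text \<open>\<open>\<rho>\<close> is the larger of \<open>|B|\<close> and \<open>\<mu>'\<close>. Its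
  successor is at most \<open>ctwo ^c \<rho>\<close>, so successor and power both remain below
  \<open>\<kappa>\<close>.\<close>

lemma strong_limit_obtain:
  fixes \<kappa> \<mu>' :: "'k rel" and B :: "'k set"
  assumes sl: "strong_limit \<kappa>" and \<mu>': "Card_order \<mu>'" "\<mu>' <o \<kappa>" and B: "infinite B" "|B| <o \<kappa>"
  obtains \<rho> :: "'k rel" where "Cinfinite \<rho>" "|B| \<le>o \<rho>" "\<mu>' \<le>o \<rho>" "cardSuc \<rho> <o \<kappa>"
    "ctwo ^c cardSuc \<rho> <o \<kappa>"
proof -
  have "\<exists>\<rho> :: 'k rel. Card_order \<rho> \<and> |B| \<le>o \<rho> \<and> \<mu>' \<le>o \<rho> \<and> \<rho> <o \<kappa>"
  proof (cases "\<mu>' <o |B|")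
    case True
    then show ?thesis
      using B(2) card_of_Card_order[of B] card_of_mono1[of B B] ordLess_imp_ordLeq by blast
  next
    case False
    then have "|B| \<le>o \<mu>'"
      using Card_order_ordLess_or_ordLeq[OF \<mu>'(1) card_of_Card_order] by blast
    then show ?thesis using \<mu>' ordLeq_refl[OF \<mu>'(1)] by blast
  qed
  then obtain \<rho> :: "'k rel" where \<rho>: "Card_order \<rho>" "|B| \<le>o \<rho>" "\<mu>' \<le>o \<rho>" "\<rho> <o \<kappa>" by blast
  have "Cinfinite \<rho>"
    using cinfinite_mono[OF \<rho>(2)] B(1) \<rho>(1) unfolding cinfinite_def Field_card_of by blast
  moreover have "cardSuc \<rho> <o \<kappa>"
    using ordLeq_ordLess_trans[OF cardSuc_least[OF \<rho>(1) Card_order_cexp ordLess_ctwo_cexp[OF \<rho>(1)]]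
        strong_limit_ctwo_cexp[OF sl \<rho>(1,4)]] .
  moreover have "ctwo ^c cardSuc \<rho> <o \<kappa>"
    using strong_limit_ctwo_cexp[OF sl cardSuc_Card_order[OF \<rho>(1)]] calculation(2) .
  ultimately show thesis using that \<rho>(2,3) by blast
qed

context
  fixes D :: "'i filter" and \<kappa> \<mu>' :: "'k rel"
  assumes D: "ultrafilter D" and sl: "strong_limit \<kappa>" and nu: "\<And>h. \<not> unbounded_mod D \<kappa> h"
    and \<mu>': "Card_order \<mu>'" "\<mu>' <o \<kappa>"
    and nd: "\<And>\<mu> :: 'k rel. Card_order \<mu> \<Longrightarrow> \<mu>' <o \<mu> \<Longrightarrow> \<mu> <o \<kappa> \<Longrightarrow> \<not> decomposable D \<mu>"
begin

lemma strong_limit_not_decomposable: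
  assumes \<mu>: "Card_order \<mu>" "\<mu>' <o \<mu>" "\<mu> <o \<kappa>"
  shows "\<not> decomposable D \<mu>"
proof
  assume dec: "decomposable D \<mu>"
  obtain r :: "'k rel" where r: "Card_order r" "\<mu> =o r"
    using exists_Card_order_ordIso[OF ordLess_imp_ordLeq[OF \<mu>(3)] \<mu>(1)] by blast
  show False
    using nd[OF r(1) ordLess_ordIso_trans[OF \<mu>(2) r(2)] ordIso_ordLess_trans[OF ordIso_symmetric[OF r(2)] \<mu>(3)]]
      decomposable_cong[OF dec r(2)] by simp
qed

text \<open>Each infinite initial segment of \<open>\<kappa>\<close> embeds in a power
  \<open>ctwo ^c cardSuc \<rho>\<close> below \<open>\<kappa>\<close>. No cardinal from
  \<open>cardSuc \<rho>\<close> up to that power is a decomposability cardinal, so the ultrapower of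
  the power is no larger than the power.\<close>

lemma strong_limit_card_of_ultrapower: "|ultrapower D (Field \<kappa>)| \<le>o \<kappa>"
proof -
  have \<kappa>: "Cinfinite \<kappa>" using sl unfolding strong_limit_def by blast
  show ?thesis
  proof (rule bounded_card_of_ultrapower[OF D \<kappa> nu])
    fix b assume "b \<in> Field \<kappa>"
    define B where "B = under \<kappa> b"
    have B: "|B| <o \<kappa>" unfolding B_def by (rule card_of_under[OF \<kappa> \<open>b \<in> Field \<kappa>\<close>])
    have "|ultrapower D B| \<le>o \<kappa>"
    proof (cases "finite B")
      case True
      then show ?thesis
        using ordLeq_transitive[OF finite_card_of_ultrapower[OF D] ordLess_imp_ordLeq[OF B]] by blast
    next
      case False
      obtain \<rho> :: "'k rel" where \<rho>: "Cinfinite \<rho>" "|B| \<le>o \<rho>" "\<mu>' \<le>o \<rho>"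
        "cardSuc \<rho> <o \<kappa>" "ctwo ^c cardSuc \<rho> <o \<kappa>"
        using strong_limit_obtain[OF sl \<mu>' False B] by blast
      have \<rho>_less: "\<rho> <o cardSuc \<rho>" using cardSuc_greater \<rho>(1) by blast
      \<comment> \<open>\<open>\<rho>\<close> may equal \<open>\<mu>'\<close>; taking its successor
        makes the whole interval lie strictly above \<open>\<mu>'\<close>.\<close>
      have up: "|ultrapower D (Field (ctwo ^c cardSuc \<rho>))| \<le>o ctwo ^c cardSuc \<rho>"
      proof (rule card_of_ultrapower_cexp[OF D Cinfinite_cardSuc[OF \<rho>(1)] Card_order_ctwo
            ordLeq_refl[OF Card_order_ctwo]])
        fix \<mu> :: "('k set \<Rightarrow> bool) rel"
        assume \<mu>: "Card_order \<mu>" "cardSuc \<rho> \<le>o \<mu>" "\<mu> \<le>o ctwo ^c cardSuc \<rho>"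
        have "\<mu>' <o \<mu>" using ordLess_ordLeq_trans[OF ordLeq_ordLess_trans[OF \<rho>(3) \<rho>_less] \<mu>(2)] .
        then show "\<not> decomposable D \<mu>"
          by (rule strong_limit_not_decomposable[OF \<mu>(1) _ ordLeq_ordLess_trans[OF \<mu>(3) \<rho>(5)]])
      qed
      have "|B| \<le>o ctwo ^c cardSuc \<rho>"
        using ordLeq_ordLess_trans[OF \<rho>(2) ordLess_transitive[OF \<rho>_less ordLess_ctwo_cexp[OF cardSuc_Card_order]]]
          \<rho>(1) ordLess_imp_ordLeq by blast
      then have "|B| \<le>o |Field (ctwo ^c cardSuc \<rho>)|"
        unfolding ordLeq_card_of_Field_iff[OF Card_order_cexp] .
      moreover have "|ultrapower D (Field (ctwo ^c cardSuc \<rho>))| \<le>o |Field (ctwo ^c cardSuc \<rho>)|"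
        using up unfolding ordLeq_card_of_Field_iff[OF Card_order_cexp] .
      ultimately have "|ultrapower D B| \<le>o ctwo ^c cardSuc \<rho>"
        unfolding ordLeq_card_of_Field_iff[OF Card_order_cexp, symmetric]
        by (rule card_of_ultrapower_mono[OF D])
      then show ?thesis using \<rho>(5) ordLess_imp_ordLeq ordLeq_transitive by blast
    qed
    then show "|ultrapower D (under \<kappa> b)| \<le>o \<kappa>" unfolding B_def .
  qed
qed

text \<open>The descent gives a family with fewer than \<open>\<kappa>\<close> indices per point,
  uniformly. It witnesses regularity at a successor \<open>cardSuc \<rho>\<close> between
  \<open>\<mu>'\<close> and \<open>\<kappa>\<close>, hence a forbidden decomposability.\<close>

lemma strong_limit_not_regular_cardSuc: "\<not> regular D (cardSuc \<kappa>) (cardSuc \<kappa>)"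
proof
  assume reg: "regular D (cardSuc \<kappa>) (cardSuc \<kappa>)"
  have \<kappa>: "Cinfinite \<kappa>" using sl unfolding strong_limit_def by blast
  have \<kappa>_le: "\<kappa> \<le>o cardSuc \<kappa>" using cardSuc_ordLeq \<kappa> by blast
  have refl: "cardSuc \<kappa> =o cardSuc \<kappa>" using ordIso_refl cardSuc_Card_order \<kappa> by blast
  from D \<kappa> refl reg show False
  proof (cases rule: regular_cardSuc_cases)
    case (unbounded h)
    then show False using nu by blast
  next
    case (few c S X)
    have less: "|underS \<kappa> c| <o \<kappa>" using card_of_underS[OF \<kappa>[THEN conjunct2] few(1)] .
    obtain \<rho> :: "'k rel" where \<rho>: "Cinfinite \<rho>" "|underS \<kappa> c| \<le>o \<rho>" "\<mu>' \<le>o \<rho>"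
        "cardSuc \<rho> <o \<kappa>"
      using strong_limit_obtain[OF sl \<mu>' few(2) less] by blast
    have \<rho>_less: "\<rho> <o cardSuc \<rho>" using cardSuc_greater \<rho>(1) by blast
    have "cardSuc \<rho> \<le>o |S|"
      using ordLeq_transitive[OF ordLess_imp_ordLeq[OF \<rho>(4)] ordLeq_transitive[OF \<kappa>_le few(3)]] .
    moreover have "|{s\<in>S. i \<in> X s}| <o cardSuc \<rho>" for i
      using ordLeq_ordLess_trans[OF ordLeq_transitive[OF few(5) \<rho>(2)] \<rho>_less] .
    ultimately have "regular D (cardSuc \<rho>) (cardSuc \<rho>)"
      using few(4) by (intro regularI[OF Cinfinite_cardSuc[OF \<rho>(1)]])
    then have "decomposable D (cardSuc \<rho>)"
      by (rule regular_imp_decomposable[OF D _ regularCard_cardSuc[OF \<rho>(1)]])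
    moreover have "\<mu>' <o cardSuc \<rho>" using ordLeq_ordLess_trans[OF \<rho>(3) \<rho>_less] .
    ultimately show False
      using strong_limit_not_decomposable[OF cardSuc_Card_order _ \<rho>(4)] \<rho>(1) by blast
  qed
qed

end

text \<open>Peels off the innermost power instead of the outermost, so that the case
  \<open>\<nu> = 2\<close> of the bound can start the iteration.\<close>

lemma is_beth_Suc:
  fixes l :: "'l rel" and b :: "'b rel"
  assumes l: "Card_order l"
  shows "is_beth l (Suc m) b \<Longrightarrow> is_beth (ctwo ^c l) m b"
proof (induction m arbitrary: b)
  case 0
  then obtain b' :: "'b rel" where b': "Card_order b" "Card_order b'" "b' =o l" "b =o ctwo ^c b'"
    by auto
  have "b =o ctwo ^c l"
    using ordIso_transitive[OF b'(4) cexp_cong2[OF b'(3) Card_order_ctwo b'(2)]] .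
  then show ?case using b'(1) by simp
next
  case (Suc m)
  then obtain b' :: "'b rel" where "Card_order b" "is_beth l (Suc m) b'" "b =o ctwo ^c b'"
    unfolding is_beth.simps(2)[of l "Suc m"] by blast
  then show ?case using Suc.IH by auto
qed

lemma ordLess_ultrapower_cexp_imp_decomposable:
  fixes \<kappa> :: "'k rel" and \<nu> :: "'n rel" and D :: "'i filter" and l :: "'l rel"
  assumes D: "ultrafilter D" and \<kappa>: "Cinfinite \<kappa>" and \<nu>: "Card_order \<nu>" and l: "is_csuc_iter \<kappa> n l"
    and less: "\<nu> ^c l <o |ultrapower D (Field (\<nu> ^c l))|"
  shows "\<exists>\<mu> :: ('k \<Rightarrow> 'n) rel. Card_order \<mu> \<and> \<kappa> \<le>o \<mu> \<and> \<mu> \<le>o \<nu> ^c \<kappa> \<and> decomposable D \<mu>"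
proof (rule ccontr)
  assume nd: "\<not> ?thesis"
  have "ctwo \<le>o \<nu>"
  proof (cases "\<exists>x\<in>Field \<nu>. \<exists>y\<in>Field \<nu>. x \<noteq> y")
    case True
    then obtain x y where xy: "x \<in> Field \<nu>" "y \<in> Field \<nu>" "x \<noteq> y" by blast
    have "|{x, y}| \<le>o \<nu>" using card_of_subset_Field[OF \<nu>] xy by simp
    then show ?thesis unfolding ctwo_def using ordIso_ordLeq_trans[OF card_of_bool[OF xy(3)]] by blast
  next
    case False
    \<comment> \<open>Here \<open>\<nu>\<close> is 0 or 1, so \<open>C\<close> has at most one
      element, and evaluating at an arbitrary point of the index type bounds the ultrapower.\<close>
    define C where "C = Func (Field l) (Field \<nu>)"
    have single: "f = g" if "f \<in> C" "g \<in> C" for f g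
    proof
      fix x
      show "f x = g x" using that False unfolding C_def Func_def by (cases "x \<in> Field l") auto
    qed
    have "|ultrapower D C| \<le>o |C|"
    proof (rule card_of_ultrapower_leI[OF D, of C "\<lambda>f. f undefined"])
      show "f undefined \<in> C" if "range f \<subseteq> C" for f using that by blast
      show "\<forall>\<^sub>F i in D. f i = g i" if "range f \<subseteq> C" "range g \<subseteq> C" for f g
        using that single by (intro always_eventually allI) blast
    qed
    then have "|ultrapower D (Field (\<nu> ^c l))| \<le>o \<nu> ^c l" unfolding C_def cexp_def Field_card_of .
    then show ?thesis using less not_ordLess_ordLeq by blast
  qed
  then have "|ultrapower D (Field (\<nu> ^c l))| \<le>o \<nu> ^c l"
    using card_of_ultrapower_cexp_csuc_iter[OF D \<kappa> \<nu> _ _ l] nd by blast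
  then show False using less not_ordLess_ordLeq by blast
qed

text \<open>Otherwise no function into \<open>\<kappa>\<close> is unbounded, and the bound passes
  from \<open>\<kappa>\<close> to \<open>l\<close> and on to \<open>b\<close>.\<close>

lemma ordLess_ultrapower_imp_regular_cf:
  fixes \<kappa> \<mu>' :: "'k rel" and D :: "'i filter" and l :: "'l rel" and b :: "'b rel"
  assumes D: "ultrafilter D" and sl: "strong_limit \<kappa>" and l: "is_csuc_iter \<kappa> n l"
    and b: "is_beth l m b" and less: "b <o |ultrapower D (Field b)|"
    and \<mu>': "Card_order \<mu>'" "\<mu>' <o \<kappa>"
    and nd: "\<And>\<mu> :: 'k rel. Card_order \<mu> \<Longrightarrow> \<mu>' <o \<mu> \<Longrightarrow> \<mu> <o \<kappa> \<Longrightarrow> \<not> decomposable D \<mu>"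
  shows "regular D (cf \<kappa>) (cf \<kappa>)"
proof (rule ccontr)
  assume ncf: "\<not> ?thesis"
  have \<kappa>: "Cinfinite \<kappa>" using sl unfolding strong_limit_def by blast
  have nu: "\<not> unbounded_mod D \<kappa> h" for h using unbounded_imp_regular_cf[OF D \<kappa>] ncf by blast
  have "|ultrapower D (Field l)| \<le>o l"
    by (rule card_of_ultrapower_csuc_iter[OF D \<kappa> strong_limit_card_of_ultrapower[OF D sl nu \<mu>' nd]
          strong_limit_not_regular_cardSuc[OF D sl nu \<mu>' nd] l])
  then have "|ultrapower D (Field b)| \<le>o b"
    using card_of_ultrapower_is_beth[OF D _ _ b] is_csuc_iter_Cinfinite[OF \<kappa> l] by blast
  then show False using less not_ordLess_ordLeq by blast
qed

theorem theorem4p3: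
  fixes \<kappa> :: "'k rel" and \<nu> :: "'n rel" and m n :: nat and D :: "'i filter"
    and \<kappa>n :: "'l rel"
  assumes "Cinfinite \<kappa>" and "Card_order \<nu>" and "ultrafilter D"
    and "is_csuc_iter \<kappa> n \<kappa>n"
  shows
    "((regular D (\<nu> ^c \<kappa>n) (\<nu> ^c \<kappa>n) \<longrightarrow>
          \<nu> ^c \<kappa>n <o |ultrapower D (Field (\<nu> ^c \<kappa>n))| ) \<and>
      (\<nu> ^c \<kappa>n <o |ultrapower D (Field (\<nu> ^c \<kappa>n))| \<longrightarrow>
          (\<exists>\<mu> :: ('k \<Rightarrow> 'n) rel. Card_order \<mu> \<and> \<kappa> \<le>o \<mu> \<and> \<mu> \<le>o \<nu> ^c \<kappa> \<and> decomposable D \<mu>) \<and>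
          (\<forall>p. is_csuc_iter \<kappa> p (\<nu> ^c \<kappa>) \<longrightarrow> regular D \<kappa> \<kappa>))) \<and>
     (\<forall>b :: 'b rel. m \<ge> 1 \<and> is_beth \<kappa>n m b \<longrightarrow>
        (regular D b b \<longrightarrow> b <o |ultrapower D (Field b)| ) \<and>
        (b <o |ultrapower D (Field b)| \<longrightarrow>
          (\<exists>\<mu> :: ('k \<Rightarrow> bool) rel. Card_order \<mu> \<and> \<kappa> \<le>o \<mu> \<and> \<mu> \<le>o ctwo ^c \<kappa> \<and> decomposable D \<mu>) \<and>
          (\<forall>p. is_csuc_iter \<kappa> p (ctwo ^c \<kappa>) \<longrightarrow> regular D \<kappa> \<kappa>))) \<and>
     (\<forall>b :: 'b rel. strong_limit \<kappa> \<and> is_beth \<kappa>n m b \<longrightarrow>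
        (regular D b b \<longrightarrow> b <o |ultrapower D (Field b)| ) \<and>
        (b <o |ultrapower D (Field b)| \<longrightarrow>
          regular D (cf \<kappa>) (cf \<kappa>) \<or>
          (\<forall>\<mu>' :: 'k rel. Card_order \<mu>' \<and> \<mu>' <o \<kappa> \<longrightarrow>
             (\<exists>\<mu> :: 'k rel. Card_order \<mu> \<and> \<mu>' <o \<mu> \<and> \<mu> <o \<kappa> \<and> decomposable D \<mu>))))"
proof (intro conjI allI impI)
  note \<kappa> = assms(1) and \<nu> = assms(2) and D = assms(3) and iter = assms(4)
  have c: "Cinfinite \<kappa>n" using is_csuc_iter_Cinfinite[OF \<kappa> iter] by blast
  show "\<nu> ^c \<kappa>n <o |ultrapower D (Field (\<nu> ^c \<kappa>n))|" if "regular D (\<nu> ^c \<kappa>n) (\<nu> ^c \<kappa>n)"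
    by (rule regular_imp_ordLess_ultrapower[OF D that])
  show dec: "\<exists>\<mu> :: ('k \<Rightarrow> 'n) rel. Card_order \<mu> \<and> \<kappa> \<le>o \<mu> \<and> \<mu> \<le>o \<nu> ^c \<kappa> \<and> decomposable D \<mu>"
    if "\<nu> ^c \<kappa>n <o |ultrapower D (Field (\<nu> ^c \<kappa>n))|"
    by (rule ordLess_ultrapower_cexp_imp_decomposable[OF D \<kappa> \<nu> iter that])
  show "regular D \<kappa> \<kappa>"
    if less: "\<nu> ^c \<kappa>n <o |ultrapower D (Field (\<nu> ^c \<kappa>n))|" and p: "is_csuc_iter \<kappa> p (\<nu> ^c \<kappa>)" for p
  proof -
    obtain \<mu> :: "('k \<Rightarrow> 'n) rel" where \<mu>: "\<kappa> \<le>o \<mu>" "\<mu> \<le>o \<nu> ^c \<kappa>" "decomposable D \<mu>"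
      using dec[OF less] by blast
    show ?thesis
      by (rule is_csuc_iter_between_regular[OF D \<kappa> \<mu>(1) decomposable_imp_regular[OF D \<mu>(3)] p \<mu>(2)])
  qed
  fix b :: "'b rel"
  show "b <o |ultrapower D (Field b)|" if "regular D b b"
    by (rule regular_imp_ordLess_ultrapower[OF D that])
  show "b <o |ultrapower D (Field b)|" if "regular D b b"
    by (rule regular_imp_ordLess_ultrapower[OF D that])
  show dec2: "\<exists>\<mu> :: ('k \<Rightarrow> bool) rel. Card_order \<mu> \<and> \<kappa> \<le>o \<mu> \<and> \<mu> \<le>o ctwo ^c \<kappa> \<and> decomposable D \<mu>"
    if m: "1 \<le> m \<and> is_beth \<kappa>n m b" and less: "b <o |ultrapower D (Field b)|"
  proof (rule ordLess_ultrapower_cexp_imp_decomposable[OF D \<kappa> Card_order_ctwo iter], rule ccontr)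
    \<comment> \<open>A bound at this first power would propagate through the remaining powers up to
      \<open>b\<close>.\<close>
    assume "\<not> ctwo ^c \<kappa>n <o |ultrapower D (Field (ctwo ^c \<kappa>n))|"
    then have up: "|ultrapower D (Field (ctwo ^c \<kappa>n))| \<le>o ctwo ^c \<kappa>n"
      using Card_order_ordLess_or_ordLeq[OF Card_order_cexp card_of_Card_order] by blast
    obtain m' where "m = Suc m'" using m by (cases m) auto
    then have "is_beth (ctwo ^c \<kappa>n) m' b" using is_beth_Suc m c by blast
    then have "|ultrapower D (Field b)| \<le>o b"
      by (rule card_of_ultrapower_is_beth[OF D Card_order_cexp up])
    then show False using less not_ordLess_ordLeq by blast
  qed
  show "regular D \<kappa> \<kappa>"
    if m: "1 \<le> m \<and> is_beth \<kappa>n m b" and less: "b <o |ultrapower D (Field b)|"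
      and p: "is_csuc_iter \<kappa> p (ctwo ^c \<kappa>)" for p
  proof -
    obtain \<mu> :: "('k \<Rightarrow> bool) rel" where \<mu>: "\<kappa> \<le>o \<mu>" "\<mu> \<le>o ctwo ^c \<kappa>" "decomposable D \<mu>"
      using dec2[OF m less] by blast
    show ?thesis
      by (rule is_csuc_iter_between_regular[OF D \<kappa> \<mu>(1) decomposable_imp_regular[OF D \<mu>(3)] p \<mu>(2)])
  qed
  show "regular D (cf \<kappa>) (cf \<kappa>) \<or>
      (\<forall>\<mu>' :: 'k rel. Card_order \<mu>' \<and> \<mu>' <o \<kappa> \<longrightarrow>
         (\<exists>\<mu> :: 'k rel. Card_order \<mu> \<and> \<mu>' <o \<mu> \<and> \<mu> <o \<kappa> \<and> decomposable D \<mu>))"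
    if sl: "strong_limit \<kappa> \<and> is_beth \<kappa>n m b" and less: "b <o |ultrapower D (Field b)|"
  proof (rule disjCI, rule ccontr)
    assume "\<not> (\<forall>\<mu>' :: 'k rel. Card_order \<mu>' \<and> \<mu>' <o \<kappa> \<longrightarrow>
         (\<exists>\<mu> :: 'k rel. Card_order \<mu> \<and> \<mu>' <o \<mu> \<and> \<mu> <o \<kappa> \<and> decomposable D \<mu>))"
      and ncf: "\<not> regular D (cf \<kappa>) (cf \<kappa>)"
    then obtain \<mu>' :: "'k rel" where \<mu>': "Card_order \<mu>'" "\<mu>' <o \<kappa>"
      and nd: "\<And>\<mu> :: 'k rel. Card_order \<mu> \<Longrightarrow> \<mu>' <o \<mu> \<Longrightarrow> \<mu> <o \<kappa> \<Longrightarrow> \<not> decomposable D \<mu>"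
      by blast
    show False
      using ordLess_ultrapower_imp_regular_cf[OF D sl[THEN conjunct1] iter sl[THEN conjunct2] less \<mu>' nd] ncf
      by blast
  qed
qed

end
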